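(* Let $E\subset\mathbb R^n$ be the closure of a bounded Lipschitz domain, $\mathscr V(E)\subset\mathscr D_0^k(E)$ an $N$-dimensional subspace, $\mathcal T=\{T_1,\dots,T_M\}\subset\mathscr A^k(E)$ a determining set for $\mathscr V(E)$, and $w_1,\dots,w_M>0$. Then the weighted discrete least squares projector $P$ satisfies $\|P\|_{\rm op}\le\mathscr M(\mathcal T,\mathscr V(E))$. Moreover, if $\mathcal H^k(\operatorname{supp}T_i\cap\operatorname{supp}T_j)=0$ for all $i\neq j$, then $\|P\|_{\rm op}=\mathscr M(\mathcal T,\mathscr V(E))$.
   Context: $\mathscr D_0^k(E)$ is the Banach space of continuous maps $E\to\Lambda^k$ with norm $\|\omega\|_0=\sup_S\mathcal H^k(S)^{-1}|\int_S\omega|$ over oriented $\mathcal H^k$-measurable $k$-rectifiable $S\subset E$ with $0<\mathcal H^k(S)<\infty$, where $\int_S\omega=\int_S\langle\omega(x);\tau(x)\rangle d\mathcal H^k(x)$, $\tau$ the orientation. $T_S(\omega)=\mathcal H^k(S)^{-1}\int_S\omega$ is an averaging current and $\mathscr A^k(E)$ is the set of all of them. The support of a continuous linear functional $T$ on $\mathscr D_0^k(E)$ is the complement in $E$ of the union of open sets $A$ with $T(\omega)=0$ for all $\omega$ supported in $A$. $\mathcal T$ is determining for $\mathscr V(E)$ if $\omega\in\mathscr V(E)$ and $T_i(\omega)=0$ for all $i$ imply $\omega=0$. Set $(\omega,\theta)_{\mathcal T,w}:=\sum_{i=1}^Mw_iT_i(\omega)T_i(\theta)$ (an inner product on $\mathscr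 V(E)$) and $P\omega:=\arg\min_{\theta\in\mathscr V(E)}(\omega-\theta,\omega-\theta)_{\mathcal T,w}$, so $P\omega=\sum_h(\omega,\eta_h)_{\mathcal T,w}\eta_h$ for any orthonormal basis $\{\eta_h\}_{h=1}^N$ of $(\mathscr V(E),(\cdot,\cdot)_{\mathcal T,w})$. Define $\mathscr M(\mathcal T,\mathscr V(E)):=\sup_{T\in\mathscr A^k(E)}\sum_{i=1}^M w_i\big|\sum_{h=1}^NT_i(\eta_h)T(\eta_h)\big|$ (independent of the orthonormal basis). $\|P\|_{\rm op}=\sup_{\|\omega\|_0=1}\|P\omega\|_0$. *)

theory Defs
  imports "HOL-Analysis.Analysis"
begin

text \<open>Ambient space: R^n is an arbitrary euclidean_space 'a, n = DIM('a).
  A k-covector (element of Lambda^k) is represented as an alternating multilinear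
  real function of lists of k vectors (value 0 on lists of other length);
  pairing with the unit simple k-vector v1 wedge ... wedge vk is evaluation at [v1,...,vk].\<close>

type_synonym 'a kform = "'a \<Rightarrow> 'a list \<Rightarrow> real"

definition kcovector :: "nat \<Rightarrow> ('a::euclidean_space list \<Rightarrow> real) \<Rightarrow> bool" where
  "kcovector k \<phi> \<longleftrightarrow>
     (\<forall>vs. length vs \<noteq> k \<longrightarrow> \<phi> vs = 0) \<and>
     (\<forall>vs i. length vs = k \<and> i < k \<longrightarrow> linear (\<lambda>v. \<phi> (vs[i := v]))) \<and>
     (\<forall>vs i j. length vs = k \<and> i < j \<and> j < k \<and> vs ! i = vs ! j \<longrightarrow> \<phi> vs = 0)"

definition hnormal :: "nat \<Rightarrow> real" where
  "hnormal k = pi powr (real k / 2) / Gamma (real k / 2 + 1) / 2 ^ k"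

definition hausdorff_outer :: "nat \<Rightarrow> 'a::euclidean_space set \<Rightarrow> ennreal" where
  "hausdorff_outer k A =
     (SUP \<delta>\<in>{0<..}. INF C\<in>{C :: nat \<Rightarrow> 'a set. A \<subseteq> (\<Union>i. C i) \<and> (\<forall>i. bounded (C i) \<and> diameter (C i) \<le> \<delta>)}.
        (\<Sum>i. ennreal (if C i = {} then 0 else hnormal k * diameter (C i) ^ k)))"

definition hmeasurable :: "nat \<Rightarrow> 'a::euclidean_space set \<Rightarrow> bool" where
  "hmeasurable k A \<longleftrightarrow>
     (\<forall>B. hausdorff_outer k B = hausdorff_outer k (B \<inter> A) + hausdorff_outer k (B - A))"

definition Hk :: "nat \<Rightarrow> 'a::euclidean_space measure" where
  "Hk k = measure_of UNIV {A. hmeasurable k A} (hausdorff_outer k)"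

text \<open>Countably k-rectifiable: covered, up to an H^k-null set, by countably many
  Lipschitz images of R^k (realised as k-dimensional linear subspaces of R^n).\<close>
definition k_rectifiable :: "nat \<Rightarrow> 'a::euclidean_space set \<Rightarrow> bool" where
  "k_rectifiable k S \<longleftrightarrow>
     (\<exists>Z L (F :: nat \<Rightarrow> 'a \<Rightarrow> 'a). hausdorff_outer k Z = 0 \<and>
        (\<forall>i. subspace (L i) \<and> dim (L i) = k \<and> (\<exists>C. C-lipschitz_on (L i) (F i))) \<and>
        S \<subseteq> Z \<union> (\<Union>i. F i ` L i))"

definition approx_tangent :: "nat \<Rightarrow> 'a::euclidean_space set \<Rightarrow> 'a \<Rightarrow> 'a set \<Rightarrow> bool" where
  "approx_tangent k S x P \<longleftrightarrow> subspace P \<and> dim P = k \<and>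
     (\<forall>f :: 'a \<Rightarrow> real. continuous_on UNIV f \<and> compact (closure {y. f y \<noteq> 0}) \<longrightarrow>
        ((\<lambda>r. (LINT y:S|Hk k. f ((1 / r) *\<^sub>R (y - x))) / r ^ k)
           \<longlongrightarrow> (LINT y:P|Hk k. f y)) (at_right 0))"

text \<open>An orientation of S: a measurable field of unit simple k-vectors
  sigma(x) * tau_0(x) wedge ... wedge tau_{k-1}(x) (orthonormal frame, sign sigma)
  orienting the approximate tangent plane H^k-a.e. on S.\<close>
definition orientation :: "nat \<Rightarrow> 'a::euclidean_space set \<Rightarrow> ('a \<Rightarrow> real) \<Rightarrow> (nat \<Rightarrow> 'a \<Rightarrow> 'a) \<Rightarrow> bool" where
  "orientation k S \<sigma> \<tau> \<longleftrightarrow>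
     (\<forall>x\<in>S. (\<sigma> x = 1 \<or> \<sigma> x = -1) \<and>
            (\<forall>i<k. \<forall>j<k. \<tau> i x \<bullet> \<tau> j x = (if i = j then 1 else 0))) \<and>
     \<sigma> \<in> borel_measurable (restrict_space (Hk k) S) \<and>
     (\<forall>i<k. \<tau> i \<in> borel_measurable (restrict_space (Hk k) S)) \<and>
     (AE x in Hk k. x \<in> S \<longrightarrow> approx_tangent k S x (span ((\<lambda>i. \<tau> i x) ` {..<k})))"

definition kpair :: "nat \<Rightarrow> 'a kform \<Rightarrow> ('a \<Rightarrow> real) \<Rightarrow> (nat \<Rightarrow> 'a \<Rightarrow> 'a) \<Rightarrow> 'a \<Rightarrow> real" where
  "kpair k \<omega> \<sigma> \<tau> x = \<sigma> x * \<omega> x (map (\<lambda>i. \<tau> i x) [0..<k])"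

definition avg_current :: "nat \<Rightarrow> 'a::euclidean_space set \<Rightarrow> ('a \<Rightarrow> real) \<Rightarrow> (nat \<Rightarrow> 'a \<Rightarrow> 'a)
    \<Rightarrow> 'a kform \<Rightarrow> real" where
  "avg_current k S \<sigma> \<tau> = (\<lambda>\<omega>. (LINT x:S|Hk k. kpair k \<omega> \<sigma> \<tau> x) / measure (Hk k) S)"

definition Ak :: "nat \<Rightarrow> 'a::euclidean_space set \<Rightarrow> ('a kform \<Rightarrow> real) set" where
  "Ak k E = {avg_current k S \<sigma> \<tau> | S \<sigma> \<tau>. S \<subseteq> E \<and> hmeasurable k S \<and> k_rectifiable k S \<and>
       0 < hausdorff_outer k S \<and> hausdorff_outer k S < \<infinity> \<and> orientation k S \<sigma> \<tau>}"

definition D0 :: "nat \<Rightarrow> 'a::euclidean_space set \<Rightarrow> 'a kform set" where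
  "D0 k E = {\<omega>. (\<forall>x\<in>E. kcovector k (\<omega> x)) \<and> (\<forall>x. x \<notin> E \<longrightarrow> \<omega> x = (\<lambda>_. 0)) \<and>
                (\<forall>vs. continuous_on E (\<lambda>x. \<omega> x vs))}"

definition norm0 :: "nat \<Rightarrow> 'a::euclidean_space set \<Rightarrow> 'a kform \<Rightarrow> real" where
  "norm0 k E \<omega> = Sup ((\<lambda>T. \<bar>T \<omega>\<bar>) ` Ak k E)"

definition fsupp :: "nat \<Rightarrow> 'a::euclidean_space set \<Rightarrow> ('a kform \<Rightarrow> real) \<Rightarrow> 'a set" where
  "fsupp k E T = E - \<Union>{A. open A \<and>
      (\<forall>\<omega>\<in>D0 k E. closure {x\<in>E. \<omega> x \<noteq> (\<lambda>_. 0)} \<subseteq> A \<longrightarrow> T \<omega> = 0)}"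

definition lipschitz_domain :: "'a::euclidean_space set \<Rightarrow> bool" where
  "lipschitz_domain \<Omega> \<longleftrightarrow> open \<Omega> \<and> bounded \<Omega> \<and> connected \<Omega> \<and> \<Omega> \<noteq> {} \<and>
     (\<forall>p\<in>frontier \<Omega>. \<exists>r>0. \<exists>e g L. norm e = 1 \<and> L-lipschitz_on {v. v \<bullet> e = 0} g \<and>
        \<Omega> \<inter> ball p r = {x\<in>ball p r. (x - p) \<bullet> e < g ((x - p) - ((x - p) \<bullet> e) *\<^sub>R e)})"

definition lincomb :: "nat \<Rightarrow> (nat \<Rightarrow> real) \<Rightarrow> (nat \<Rightarrow> 'a kform) \<Rightarrow> 'a kform" where
  "lincomb N c b = (\<lambda>x vs. \<Sum>h<N. c h * b h x vs)"

definition fsubspace :: "'a kform set \<Rightarrow> bool" where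
  "fsubspace V \<longleftrightarrow> (\<lambda>x vs. 0) \<in> V \<and>
     (\<forall>a. \<forall>\<omega>\<in>V. \<forall>\<theta>\<in>V. (\<lambda>x vs. a * \<omega> x vs + \<theta> x vs) \<in> V)"

definition has_dim :: "'a kform set \<Rightarrow> nat \<Rightarrow> bool" where
  "has_dim V N \<longleftrightarrow> (\<exists>b. (\<forall>h<N. b h \<in> V) \<and>
     (\<forall>c. lincomb N c b = (\<lambda>x vs. 0) \<longrightarrow> (\<forall>h<N. c h = 0)) \<and>
     (\<forall>\<omega>\<in>V. \<exists>c. \<omega> = lincomb N c b))"

definition determining :: "nat \<Rightarrow> (nat \<Rightarrow> 'a kform \<Rightarrow> real) \<Rightarrow> 'a kform set \<Rightarrow> bool" where
  "determining M T V \<longleftrightarrow> (\<forall>\<omega>\<in>V. (\<forall>i<M. T i \<omega> = 0) \<longrightarrow> \<omega> = (\<lambda>x vs. 0))"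

definition ipTw :: "nat \<Rightarrow> (nat \<Rightarrow> 'a kform \<Rightarrow> real) \<Rightarrow> (nat \<Rightarrow> real) \<Rightarrow> 'a kform \<Rightarrow> 'a kform \<Rightarrow> real" where
  "ipTw M T w \<omega> \<theta> = (\<Sum>i<M. w i * T i \<omega> * T i \<theta>)"

definition lsq_proj :: "nat \<Rightarrow> (nat \<Rightarrow> 'a kform \<Rightarrow> real) \<Rightarrow> (nat \<Rightarrow> real) \<Rightarrow> 'a kform set \<Rightarrow> 'a kform \<Rightarrow> 'a kform" where
  "lsq_proj M T w V \<omega> = (THE \<theta>. \<theta> \<in> V \<and> (\<forall>\<theta>'\<in>V.
      ipTw M T w (\<lambda>x vs. \<omega> x vs - \<theta> x vs) (\<lambda>x vs. \<omega> x vs - \<theta> x vs)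
      \<le> ipTw M T w (\<lambda>x vs. \<omega> x vs - \<theta>' x vs) (\<lambda>x vs. \<omega> x vs - \<theta>' x vs)))"

definition is_onb :: "nat \<Rightarrow> (nat \<Rightarrow> 'a kform \<Rightarrow> real) \<Rightarrow> (nat \<Rightarrow> real) \<Rightarrow> 'a kform set \<Rightarrow> nat \<Rightarrow> (nat \<Rightarrow> 'a kform) \<Rightarrow> bool" where
  "is_onb M T w V N \<eta> \<longleftrightarrow> (\<forall>h<N. \<eta> h \<in> V) \<and>
     (\<forall>h<N. \<forall>h'<N. ipTw M T w (\<eta> h) (\<eta> h') = (if h = h' then 1 else 0)) \<and>
     (\<forall>\<omega>\<in>V. \<exists>c. \<omega> = lincomb N c \<eta>)"

definition Mconst :: "nat \<Rightarrow> 'a::euclidean_space set \<Rightarrow> nat \<Rightarrow> (nat \<Rightarrow> 'a kform \<Rightarrow> real) \<Rightarrow> (nat \<Rightarrow> real)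
    \<Rightarrow> 'a kform set \<Rightarrow> nat \<Rightarrow> real" where
  "Mconst k E M T w V N = (let \<eta> = (SOME \<eta>. is_onb M T w V N \<eta>) in
     Sup ((\<lambda>S. \<Sum>i<M. w i * \<bar>\<Sum>h<N. T i (\<eta> h) * S (\<eta> h)\<bar>) ` Ak k E))"

definition opnorm0 :: "nat \<Rightarrow> 'a::euclidean_space set \<Rightarrow> ('a kform \<Rightarrow> 'a kform) \<Rightarrow> real" where
  "opnorm0 k E P = Sup {norm0 k E (P \<omega>) | \<omega>. \<omega> \<in> D0 k E \<and> norm0 k E \<omega> = 1}"

end

theory Submission
  imports Defs "Jordan_Normal_Form.Determinant"
begin

text \<open>For an orthonormal basis \<open>\<eta>\<close> and an averaging current \<open>S\<close> one has
  \<open>S (P \<omega>) = (\<Sum>i. w i * T i \<omega> * g i)\<close> with \<open>g i = (\<Sum>h. T i (\<eta> h) * S (\<eta> h))\<close>; since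
  \<open>\<bar>T i \<omega>\<bar> \<le> \<parallel>\<omega>\<parallel>\<close>, the upper bound follows. Equality needs a form \<open>\<omega>\<close> with \<open>\<parallel>\<omega>\<parallel> \<le> 1\<close> and
  \<open>T i \<omega>\<close> close to \<open>sgn (g i)\<close> for all \<open>i\<close> at once. The measure \<open>Hk k\<close> is Borel regular and each
  carrier is almost contained in the support of its current, so the carriers of the \<open>T i\<close> have null
  intersections. Up to small measure they are exhausted by finitely many disjoint compact pieces on
  which the tangent frame is almost constant. There \<open>\<omega>\<close> is the determinant form of that frame; it has
  comass at most 1 on all of space because the determinant of a contraction is at most 1.\<close>

subsection \<open>Hausdorff outer measure\<close>

no_notation scalar_prod (infix "\<bullet>" 70)

text \<open>A test form for the equality must respect a bound against every current carried by
  \<open>E\<close>, although only the given \<open>T i\<close> matter for its values. A pointwise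
  bound over all orthonormal frames settles all currents at once, and gluing by bumps keeps it
  because at most one summand is alive at each point. The frames are only measurable, so no
  continuous form need be exactly dual to them; a Lusin-type cut trades this for constant covectors,
  at the price of a small measure and a small angle. The construction serves twice: inside an
  arbitrary open \<open>A\<close> it shows that a current vanishing on forms supported in
  \<open>A\<close> has a carrier null in \<open>A\<close>, and with \<open>A = UNIV\<close> it gives
  the nearly extremal form, the wanted signs being absorbed into the orientations. Since every
  supremum is a real \<open>Sup\<close>, boundedness and nonemptiness have to be proved along the
  way; the cases of no averaging current at all and of \<open>M = 0\<close> are therefore
  separate.\<close>

definition hterm :: "nat \<Rightarrow> 'a::euclidean_space set \<Rightarrow> ennreal" where
  "hterm k C = ennreal (if C = {} then 0 else hnormal k * diameter C ^ k)"

definition hcover :: "real \<Rightarrow> 'a::euclidean_space set \<Rightarrow> (nat \<Rightarrow> 'a set) set" where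
  "hcover \<delta> A = {C. A \<subseteq> (\<Union>i. C i) \<and> (\<forall>i. bounded (C i) \<and> diameter (C i) \<le> \<delta>)}"

definition hpre :: "nat \<Rightarrow> real \<Rightarrow> 'a::euclidean_space set \<Rightarrow> ennreal" where
  "hpre k \<delta> A = (INF C\<in>hcover \<delta> A. \<Sum>i. hterm k (C i))"

lemma hausdorff_outer_hpre: "hausdorff_outer k A = (SUP \<delta>\<in>{0<..}. hpre k \<delta> A)"
  by (simp add: hausdorff_outer_def hpre_def hcover_def hterm_def)

text \<open>The convention matters for \<open>k = 0\<close>, where \<open>diameter {} ^ 0\<close> is
  1. It lets covers be padded with empty sets at no cost.\<close>

lemma hterm_empty [simp]: "hterm k {} = 0"
  by (simp add: hterm_def)

lemma hterm_closure: "bounded C \<Longrightarrow> hterm k (closure C) = hterm k C"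
  by (simp add: hterm_def diameter_closure)

lemma hpre_mono: "A \<subseteq> B \<Longrightarrow> hpre k \<delta> A \<le> hpre k \<delta> B"
  unfolding hpre_def by (rule INF_superset_mono) (auto simp: hcover_def)

lemma hpre_antimono: "\<delta> \<le> \<delta>' \<Longrightarrow> hpre k \<delta>' A \<le> hpre k \<delta> A"
  unfolding hpre_def by (rule INF_superset_mono) (auto simp: hcover_def intro: order_trans)

lemma hpre_le_hausdorff_outer: "0 < \<delta> \<Longrightarrow> hpre k \<delta> A \<le> hausdorff_outer k A"
  unfolding hausdorff_outer_hpre by (rule SUP_upper) auto

lemma hpre_approx:
  assumes "hpre k \<delta> A < \<infinity>" "0 < e"
  obtains C where "C \<in> hcover \<delta> A" "(\<Sum>i. hterm k (C i)) \<le> hpre k \<delta> A + e"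
proof -
  have "hpre k \<delta> A < hpre k \<delta> A + e"
    using assms by (simp add: ennreal_add_left_cancel_less)
  then obtain C where "C \<in> hcover \<delta> A" "(\<Sum>i. hterm k (C i)) < hpre k \<delta> A + e"
    unfolding hpre_def INF_less_iff by blast
  then show ?thesis
    using that less_imp_le by blast
qed

lemma hpre_empty:
  assumes "0 < \<delta>" shows "hpre k \<delta> ({} :: 'a::euclidean_space set) = 0"
proof -
  have "hpre k \<delta> ({} :: 'a set) \<le> (\<Sum>i::nat. hterm k ((\<lambda>_. {}) i :: 'a set))"
    unfolding hpre_def using assms by (rule_tac INF_lower) (auto simp: hcover_def)
  then show ?thesis by simp
qed

text \<open>Covers of the \<open>A n\<close> with excess \<open>e / 2 ^ (n+1)\<close> are merged
  into one sequence by \<open>prod_decode\<close>; the excesses add up to \<open>e\<close>.\<close>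

lemma hpre_countably_subadditive:
  fixes A :: "nat \<Rightarrow> 'a::euclidean_space set"
  shows "hpre k \<delta> (\<Union>n. A n) \<le> (\<Sum>n. hpre k \<delta> (A n))"
proof (rule ennreal_le_epsilon)
  fix e :: real assume e: "0 < e" and fin: "(\<Sum>n. hpre k \<delta> (A n)) < Orderings.top"
  have geom: "(\<Sum>n. ennreal (e * (1/2) ^ Suc n)) = ennreal e"
  proof -
    have "(\<lambda>n. e * (1/2) ^ Suc n) sums (e * 1)"
      by (intro sums_mult power_half_series)
    then show ?thesis
      using e by (subst suminf_ennreal2) (auto simp: sums_iff)
  qed
  have finn: "hpre k \<delta> (A n) < \<infinity>" for n
    using fin ennreal_suminf_lessD fin by fastforce
  have "\<exists>C. C \<in> hcover \<delta> (A n) \<and> (\<Sum>i. hterm k (C i)) \<le> hpre k \<delta> (A n) + ennreal (e * (1/2) ^ Suc n)" for n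
    using hpre_approx[OF finn, of "ennreal (e * (1/2) ^ Suc n)" n] e by auto
  then obtain C where C: "\<And>n. C n \<in> hcover \<delta> (A n)"
      "\<And>n. (\<Sum>i. hterm k (C n i)) \<le> hpre k \<delta> (A n) + ennreal (e * (1/2) ^ Suc n)"
    by metis
  define D where "D i = case_prod C (prod_decode i)" for i
  have "D \<in> hcover \<delta> (\<Union>n. A n)"
  proof -
    have "x \<in> (\<Union>i. D i)" if x: "x \<in> A n" for x n
    proof -
      obtain i where "x \<in> C n i"
        using C(1)[of n] x by (auto simp: hcover_def)
      then have "x \<in> D (prod_encode (n, i))" by (simp add: D_def)
      then show ?thesis by blast
    qed
    moreover have "bounded (D i) \<and> diameter (D i) \<le> \<delta>" for i
      using C(1) by (auto simp: D_def hcover_def split: prod.split)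
    ultimately show ?thesis unfolding hcover_def by blast
  qed
  then have "hpre k \<delta> (\<Union>n. A n) \<le> (\<Sum>i. hterm k (D i))"
    unfolding hpre_def by (rule INF_lower)
  also have "\<dots> = (\<Sum>i. (\<lambda>(n, i). hterm k (C n i)) (prod_decode i))"
    by (intro suminf_cong) (simp add: D_def split: prod.split)
  also have "\<dots> = (\<Sum>n. \<Sum>i. hterm k (C n i))"
    by (rule suminf_ennreal_2dimen) simp
  also have "\<dots> \<le> (\<Sum>n. hpre k \<delta> (A n) + ennreal (e * (1/2) ^ Suc n))"
    by (intro suminf_le C(2)) auto
  also have "\<dots> = (\<Sum>n. hpre k \<delta> (A n)) + (\<Sum>n. ennreal (e * (1/2) ^ Suc n))"
    by (intro suminf_add[symmetric]) auto
  finally show "hpre k \<delta> (\<Union>n. A n) \<le> (\<Sum>n. hpre k \<delta> (A n)) + ennreal e"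
    by (simp only: geom)
qed

lemma hausdorff_outer_mono: "A \<subseteq> B \<Longrightarrow> hausdorff_outer k A \<le> hausdorff_outer k B"
  unfolding hausdorff_outer_hpre by (intro SUP_mono) (auto intro: hpre_mono)

lemma hausdorff_outer_empty: "hausdorff_outer k {} = 0"
  unfolding hausdorff_outer_hpre by (auto simp: hpre_empty intro: antisym SUP_least)

lemma hausdorff_outer_countably_subadditive:
  "hausdorff_outer k (\<Union>n. A n) \<le> (\<Sum>n. hausdorff_outer k (A (n::nat)))"
proof -
  have "hpre k \<delta> (\<Union>n. A n) \<le> (\<Sum>n. hausdorff_outer k (A n))" if "0 < \<delta>" for \<delta>
    by (rule order_trans[OF hpre_countably_subadditive])
       (use that in \<open>auto intro!: suminf_le hpre_le_hausdorff_outer\<close>)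
  then show ?thesis
    by (subst hausdorff_outer_hpre) (auto intro: SUP_least)
qed

lemma hausdorff_outer_subadditive:
  "hausdorff_outer k (A \<union> B) \<le> hausdorff_outer k A + hausdorff_outer k B"
proof -
  have "(\<Union>n::nat. (if n = 0 then A else if n = 1 then B else {})) = A \<union> B" (is "(\<Union>n::nat. ?F n) = _")
    by (auto split: if_splits)
  moreover have "(\<Sum>n. hausdorff_outer k (?F (n::nat))) = (\<Sum>n\<in>{0,1}. hausdorff_outer k (?F n))"
    by (rule suminf_finite) (auto simp: hausdorff_outer_empty)
  ultimately show ?thesis
    using hausdorff_outer_countably_subadditive[where A="?F" and k=k] by simp
qed

text \<open>A set of diameter at most \<delta> cannot meet both \<open>A\<close> and
  \<open>B\<close>. Blanking out the members that miss one side thus splits a cover of the union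
  into two covers without using any term twice.\<close>

lemma hpre_separated:
  assumes sep: "\<And>x y. x \<in> A \<Longrightarrow> y \<in> B \<Longrightarrow> \<delta> < dist x y"
  shows "hpre k \<delta> A + hpre k \<delta> B \<le> hpre k \<delta> (A \<union> B)"
proof (subst (3) hpre_def, rule INF_greatest)
  fix C assume C: "C \<in> hcover \<delta> (A \<union> B)"
  define C1 where "C1 i = (if C i \<inter> A \<noteq> {} then C i else {})" for i
  define C2 where "C2 i = (if C i \<inter> B \<noteq> {} then C i else {})" for i
  have C': "\<And>i. bounded (C i)" "\<And>i. diameter (C i) \<le> \<delta>" "A \<union> B \<subseteq> (\<Union>i. C i)"
    using C by (auto simp: hcover_def)
  \<comment> \<open>Nonnegativity makes the empty set, of diameter 0, an admissible member of
    \<open>C1\<close> and \<open>C2\<close>.\<close>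
  have "0 \<le> \<delta>"
    using C'(2)[of 0] diameter_ge_0[OF C'(1)[of 0]] by linarith
  then have 1: "C1 \<in> hcover \<delta> A" and 2: "C2 \<in> hcover \<delta> B"
    using C' by (fastforce simp: hcover_def C1_def C2_def)+
  have "hterm k (C1 i) + hterm k (C2 i) \<le> hterm k (C i)" for i
  proof -
    have "C i \<inter> A = {} \<or> C i \<inter> B = {}"
    proof (rule ccontr)
      assume "\<not> ?thesis"
      then obtain x y where xy: "x \<in> C i" "x \<in> A" "y \<in> C i" "y \<in> B" by blast
      then have "dist x y \<le> diameter (C i)"
        using C'(1) diameter_bounded_bound by blast
      then show False
        using C'(2)[of i] sep[OF xy(2,4)] by simp
    qed
    then show ?thesis by (auto simp: C1_def C2_def)
  qed
  then have "(\<Sum>i. hterm k (C1 i) + hterm k (C2 i)) \<le> (\<Sum>i. hterm k (C i))"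
    by (intro suminf_le) auto
  moreover have "hpre k \<delta> A + hpre k \<delta> B \<le> (\<Sum>i. hterm k (C1 i)) + (\<Sum>i. hterm k (C2 i))"
    unfolding hpre_def by (intro add_mono INF_lower 1 2)
  ultimately show "hpre k \<delta> A + hpre k \<delta> B \<le> (\<Sum>i. hterm k (C i))"
    by (simp add: suminf_add[symmetric])
qed

text \<open>Only scales below the gap matter, because \<open>hpre\<close> grows as the scale
  shrinks. The same monotonicity lets the supremum of the sums split into a sum of suprema.\<close>

lemma hausdorff_outer_separated:
  assumes d: "0 < d" and sep: "\<And>x y. x \<in> A \<Longrightarrow> y \<in> B \<Longrightarrow> d \<le> dist x y"
  shows "hausdorff_outer k A + hausdorff_outer k B \<le> hausdorff_outer k (A \<union> B)"
proof -
  have "hausdorff_outer k A + hausdorff_outer k B = (SUP \<delta>\<in>{0<..}. hpre k \<delta> A + hpre k \<delta> B)"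
    unfolding hausdorff_outer_hpre
  proof (rule SUP_add_directed_ennreal[symmetric])
    fix i j :: real assume "i \<in> {0<..}" "j \<in> {0<..}"
    then show "\<exists>l\<in>{0<..}. hpre k i A + hpre k j B \<le> hpre k l A + hpre k l B"
      by (intro bexI[of _ "min i j"] add_mono hpre_antimono) auto
  qed
  also have "\<dots> \<le> hausdorff_outer k (A \<union> B)"
  proof (rule SUP_least)
    fix \<delta> :: real assume \<delta>: "\<delta> \<in> {0<..}"
    \<comment> \<open>Half the gap, because \<open>hpre_separated\<close> asks for distances
      strictly above the scale.\<close>
    let ?m = "min \<delta> (d/2)"
    have "hpre k \<delta> A + hpre k \<delta> B \<le> hpre k ?m A + hpre k ?m B"
      by (intro add_mono hpre_antimono) auto
    also have "\<dots> \<le> hpre k ?m (A \<union> B)"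
      using d by (intro hpre_separated) (fastforce dest: sep)
    also have "\<dots> \<le> hausdorff_outer k (A \<union> B)"
      using d \<delta> by (intro hpre_le_hausdorff_outer) auto
    finally show "hpre k \<delta> A + hpre k \<delta> B \<le> hausdorff_outer k (A \<union> B)" .
  qed
  finally show ?thesis .
qed

lemma hausdorff_outer_sum_separated:
  fixes R :: "nat \<Rightarrow> 'a::euclidean_space set"
  assumes sep: "\<And>i j. i < j \<Longrightarrow> \<exists>d>0. \<forall>x\<in>R i. \<forall>y\<in>R j. d \<le> dist x y"
  shows "(\<Sum>i<n. hausdorff_outer k (R i)) \<le> hausdorff_outer k (\<Union>i<n. R i)"
proof (induction n)
  case 0
  then show ?case by simp
next
  case (Suc n)
  obtain d where d: "\<And>i. i < n \<Longrightarrow> 0 < d i \<and> (\<forall>x\<in>R i. \<forall>y\<in>R n. d i \<le> dist x y)"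
    using sep[of _ n] by metis
  \<comment> \<open>\<open>insert 1\<close> gives \<open>Min\<close> a nonempty set when
    \<open>n = 0\<close>.\<close>
  define m where "m = Min (insert 1 (d ` {..<n}))"
  have "0 < m"
    unfolding m_def using d by (subst Min_gr_iff) auto
  moreover have "m \<le> dist x y" if xy: "x \<in> (\<Union>i<n. R i)" "y \<in> R n" for x y
  proof -
    obtain i where i: "i < n" "x \<in> R i" using xy by auto
    have "m \<le> d i" unfolding m_def using i by (intro Min_le) auto
    also have "\<dots> \<le> dist x y" using d i xy by blast
    finally show ?thesis .
  qed
  ultimately have "hausdorff_outer k (\<Union>i<n. R i) + hausdorff_outer k (R n)
      \<le> hausdorff_outer k ((\<Union>i<n. R i) \<union> R n)"
    by (rule hausdorff_outer_separated)
  moreover have "(\<Union>i<n. R i) \<union> R n = (\<Union>i<Suc n. R i)"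
    by (auto simp: less_Suc_eq)
  ultimately show ?case
    using Suc by (auto intro: order_trans add_right_mono)
qed

text \<open>The shells \<open>R n\<close> around \<open>C\<close> are separated when their indices differ by at least 2, so the sums
  of their measures over even and over odd indices converge.\<close>
lemma closed_hmeasurable:
  fixes C :: "'a::euclidean_space set"
  assumes C: "closed C" shows "hmeasurable k C"
proof (cases "C = {}")
  \<comment> \<open>Treated apart because \<open>infdist x {}\<close> is 0 by convention, so that
    distance zero would not mean membership.\<close>
  case True
  then show ?thesis by (simp add: hmeasurable_def hausdorff_outer_empty)
next
  case ne: False
  define H where "H = (hausdorff_outer k :: 'a set \<Rightarrow> ennreal)"
  have "H (B \<inter> C) + H (B - C) \<le> H B" if fin: "H B < \<infinity>" for B
  proof -
    define a :: "nat \<Rightarrow> real" where "a n = inverse (real (Suc n))" for n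
    define Q where "Q n = {x\<in>B. a n \<le> infdist x C}" for n
    define R where "R n = {x\<in>B. a (Suc n) \<le> infdist x C \<and> infdist x C < a n}" for n
    have a_less: "a m < a n" if "n < m" for m n
      using that by (simp add: a_def)
    have a_le: "a m \<le> a n" if "n \<le> m" for m n
      using that by (simp add: a_def)
    have a_pos: "0 < a n" for n by (simp add: a_def)
    \<comment> \<open>Consecutive shells may touch. With an index strictly between, the triangle
      inequality for \<open>infdist\<close> leaves the gap \<open>a (Suc i) - a j\<close>.\<close>
    have sepR: "\<exists>d>0. \<forall>x\<in>R i. \<forall>y\<in>R j. d \<le> dist x y" if "Suc i < j" for i j
    proof (intro exI conjI ballI)
      show "0 < a (Suc i) - a j" using a_less[OF that] by simp
      fix x y assume "x \<in> R i" "y \<in> R j"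
      then show "a (Suc i) - a j \<le> dist x y"
        using infdist_triangle[of x C y] by (auto simp: R_def)
    qed
    have RB: "H (\<Union>i\<in>I. R (f i)) \<le> H B" for I :: "nat set" and f
      unfolding H_def by (rule hausdorff_outer_mono) (auto simp: R_def)
    have even: "(\<Sum>i<n. H (R (2 * i))) \<le> H B" for n
      by (rule order_trans[OF _ RB[of "\<lambda>i. 2 * i" "{..<n}"]])
         (unfold H_def, rule hausdorff_outer_sum_separated, rule sepR, simp)
    have odd: "(\<Sum>i<n. H (R (2 * i + 1))) \<le> H B" for n
      by (rule order_trans[OF _ RB[of "\<lambda>i. 2 * i + 1" "{..<n}"]])
         (unfold H_def, rule hausdorff_outer_sum_separated, rule sepR, simp)
    have sum2: "(\<Sum>i<2*n. H (R i)) = (\<Sum>i<n. H (R (2 * i))) + (\<Sum>i<n. H (R (2 * i + 1)))" for n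
      by (induction n) (simp_all add: ac_simps)
    have "(\<Sum>i. H (R i)) \<le> H B + H B"
    proof (rule suminf_le_const)
      fix n
      have "(\<Sum>i<n. H (R i)) \<le> (\<Sum>i<2*n. H (R i))"
        by (intro sum_mono2) auto
      also have "\<dots> \<le> H B + H B"
        unfolding sum2 by (intro add_mono even odd)
      finally show "(\<Sum>i<n. H (R i)) \<le> H B + H B" .
    qed simp
    also have "\<dots> < \<infinity>" using fin by simp
    finally have fins: "(\<Sum>i. H (R i)) < \<infinity>" .
    \<comment> \<open>Real copies of the shell measures: the tails of a summable real series tend to
      0, which closes the argument.\<close>
    define r where "r i = enn2real (H (R i))" for i
    have r: "H (R i) = ennreal (r i)" for i
    proof -
      have "H (R i) < \<infinity>"
        using RB[of "\<lambda>_. i" UNIV] fin by (auto intro: le_less_trans)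
      then show ?thesis by (simp add: r_def)
    qed
    have r0: "0 \<le> r i" for i by (simp add: r_def)
    have sr: "summable r"
      using fins unfolding r by (intro summable_suminf_not_top) (auto simp: r0)
    have main: "H (B \<inter> C) + H (B - C) \<le> H B + ennreal (\<Sum>i. r (i + n))" for n
    proof -
      have "B - C \<subseteq> Q n \<union> (\<Union>i. R (i + n))"
      proof
        fix x assume x: "x \<in> B - C"
        then have "0 < infdist x C"
          using in_closed_iff_infdist_zero[OF C ne, of x] infdist_nonneg[of x C] by auto
        then obtain m where m: "a m < infdist x C"
          using reals_Archimedean[of "infdist x C"] unfolding a_def by auto
        show "x \<in> Q n \<union> (\<Union>i. R (i + n))"
        proof (cases "a n \<le> infdist x C")
          case True
          then show ?thesis using x by (auto simp: Q_def)
        next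
          case False
          \<comment> \<open>\<open>p\<close> is the first level not above the distance of
            \<open>x\<close>. Since that distance is below \<open>a n\<close>, \<open>p\<close>
            exceeds \<open>n\<close> and \<open>x\<close> falls into shell
            \<open>p - 1\<close>.\<close>
          define p where "p = (LEAST m. a m \<le> infdist x C)"
          have p: "a p \<le> infdist x C" unfolding p_def using m by (metis LeastI less_imp_le)
          have np: "n < p" using False p a_le[of p n] by (cases "n < p") auto
          have "\<not> a (p - 1) \<le> infdist x C"
            using not_less_Least[of "p - 1" "\<lambda>m. a m \<le> infdist x C"] np unfolding p_def[symmetric] by auto
          then have "x \<in> R (p - 1)"
            using p np x by (auto simp: R_def)
          then have "x \<in> R ((p - 1 - n) + n)"
            using np by simp
          then show ?thesis by blast
        qed
      qed
      then have "H (B - C) \<le> H (Q n \<union> (\<Union>i. R (i + n)))"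
        unfolding H_def by (rule hausdorff_outer_mono)
      also have "\<dots> \<le> H (Q n) + H (\<Union>i. R (i + n))"
        unfolding H_def by (rule hausdorff_outer_subadditive)
      also have "H (\<Union>i. R (i + n)) \<le> (\<Sum>i. H (R (i + n)))"
        unfolding H_def by (rule hausdorff_outer_countably_subadditive)
      also have "\<dots> = ennreal (\<Sum>i. r (i + n))"
        unfolding r using sr r0 by (intro suminf_ennreal2) (auto intro: summable_ignore_initial_segment)
      finally have 1: "H (B - C) \<le> H (Q n) + ennreal (\<Sum>i. r (i + n))"
        by (simp add: add_left_mono)
      have "H (B \<inter> C) + H (Q n) \<le> H ((B \<inter> C) \<union> Q n)"
        unfolding H_def
      proof (rule hausdorff_outer_separated[OF a_pos[of n]])
        fix x y assume "x \<in> B \<inter> C" "y \<in> Q n"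
        then show "a n \<le> dist x y"
          using infdist_le[of x C y] by (auto simp: Q_def dist_commute)
      qed
      also have "\<dots> \<le> H B"
        unfolding H_def by (rule hausdorff_outer_mono) (auto simp: Q_def)
      finally have 2: "H (B \<inter> C) + H (Q n) \<le> H B" .
      have "H (B \<inter> C) + H (B - C) \<le> H (B \<inter> C) + (H (Q n) + ennreal (\<Sum>i. r (i + n)))"
        using 1 by (intro add_left_mono)
      also have "\<dots> = (H (B \<inter> C) + H (Q n)) + ennreal (\<Sum>i. r (i + n))"
        by (simp add: ac_simps)
      also have "\<dots> \<le> H B + ennreal (\<Sum>i. r (i + n))"
        using 2 by (intro add_right_mono)
      finally show ?thesis .
    qed
    show ?thesis
    proof (rule ennreal_le_epsilon)
      fix e :: real assume e: "0 < e"
      obtain n where "norm (\<Sum>i. r (i + n)) < e"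
        using suminf_exist_split[OF e sr] by auto
      then have "ennreal (\<Sum>i. r (i + n)) \<le> ennreal e"
        by (intro ennreal_leI) auto
      then show "H (B \<inter> C) + H (B - C) \<le> H B + ennreal e"
        using main[of n] by (meson add_left_mono order_trans)
    qed
  qed
  then have "H (B \<inter> C) + H (B - C) \<le> H B" for B
    by (cases "H B < \<infinity>") (auto simp: less_top[symmetric])
  moreover have "H B \<le> H (B \<inter> C) + H (B - C)" for B
    using hausdorff_outer_subadditive[of k "B \<inter> C" "B - C"]
    by (simp add: H_def Int_Diff_Un)
  ultimately show ?thesis
    unfolding hmeasurable_def H_def by (auto intro: antisym)
qed

subsection \<open>The Hausdorff measure: Borel sets and regularity\<close>

text \<open>Caratheodory's condition is the library's with the sides of the equation swapped, which
  makes \<open>caratheodory_lemma\<close> applicable.\<close>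

lemma hmeasurable_lambda_system:
  "{A. hmeasurable k A} = lambda_system UNIV (Pow UNIV) (hausdorff_outer k)"
proof -
  interpret Sigma_Algebra.algebra UNIV "Pow UNIV :: 'a set set" by (rule algebra_Pow)
  show ?thesis by (subst lambda_system_eq) (unfold hmeasurable_def, blast intro: sym)
qed

lemma measure_space_hausdorff:
  "measure_space UNIV {A :: 'a::euclidean_space set. hmeasurable k A} (hausdorff_outer k)"
proof -
  interpret sigma_algebra UNIV "Pow UNIV :: 'a set set" by (rule sigma_algebra_Pow)
  show ?thesis
    unfolding hmeasurable_lambda_system
  proof (rule caratheodory_lemma)
    show "outer_measure_space (Pow UNIV) (hausdorff_outer k :: 'a set \<Rightarrow> ennreal)"
      by (auto simp: outer_measure_space_def positive_def increasing_def countably_subadditive_def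
          hausdorff_outer_empty hausdorff_outer_mono hausdorff_outer_countably_subadditive)
  qed
qed

lemma space_Hk [simp]: "space (Hk k) = UNIV"
  by (simp add: Hk_def)

lemma sets_Hk: "sets (Hk k :: 'a::euclidean_space measure) = {A. hmeasurable k A}"
proof -
  interpret sigma_algebra UNIV "{A :: 'a set. hmeasurable k A}"
    using measure_space_hausdorff[where 'a='a and k=k] by (simp add: measure_space_def)
  show ?thesis unfolding Hk_def by (simp add: sets_measure_of sigma_sets_eq)
qed

lemma emeasure_Hk: "hmeasurable k A \<Longrightarrow> emeasure (Hk k) A = hausdorff_outer k A"
  using measure_space_hausdorff unfolding Hk_def
  by (intro emeasure_measure_of_sigma) (auto simp: measure_space_def)

lemma borel_subset_Hk: "sets borel \<subseteq> sets (Hk k)"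
proof -
  have "sets (sigma UNIV (Collect closed)) \<subseteq> sets (Hk k :: 'a measure)"
    using closed_hmeasurable sets.sigma_sets_subset[of "Collect closed" "Hk k :: 'a measure"]
    by (auto simp: sets_Hk)
  then show ?thesis by (simp add: borel_eq_closed)
qed

lemma measurable_Hk_borel: "f \<in> borel_measurable borel \<Longrightarrow> f \<in> borel_measurable (Hk k)"
  using borel_subset_Hk[of k] by (auto simp: measurable_def)

text \<open>Closures have the same diameter and so cost nothing in a cover. Intersecting the unions
  of closed covers of scale and excess \<open>1/(n+1)\<close> gives a Borel hull of equal measure;
  \<open>A\<close> need not be measurable.\<close>

lemma borel_regular_Hk:
  fixes A :: "'a::euclidean_space set"
  assumes fin: "hausdorff_outer k A < \<infinity>"
  obtains B where "B \<in> sets borel" "A \<subseteq> B" "hausdorff_outer k B = hausdorff_outer k A"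
proof -
  define d :: "nat \<Rightarrow> real" where "d n = inverse (real (Suc n))" for n
  have d0: "0 < d n" for n by (simp add: d_def)
  have "hpre k (d n) A < \<infinity>" for n
    using hpre_le_hausdorff_outer[OF d0] fin by (rule le_less_trans)
  then have "\<exists>C. C \<in> hcover (d n) A \<and> (\<Sum>i. hterm k (C i)) \<le> hpre k (d n) A + ennreal (d n)" for n
    by (rule hpre_approx[of k "d n" A "ennreal (d n)"]) (auto simp: d0)
  then obtain C where C: "\<And>n. C n \<in> hcover (d n) A"
      "\<And>n. (\<Sum>i. hterm k (C n i)) \<le> hpre k (d n) A + ennreal (d n)"
    by metis
  define B where "B = (\<Inter>n. \<Union>i. closure (C n i))"
  have bd: "bounded (C n i)" "diameter (C n i) \<le> d n" for n i
    using C(1)[of n] by (auto simp: hcover_def)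
  have AB: "A \<subseteq> B"
  proof
    fix x assume "x \<in> A"
    then have "\<exists>i. x \<in> C n i" for n
      using C(1)[of n] by (auto simp: hcover_def)
    then have "\<exists>i. x \<in> closure (C n i)" for n
      using closure_subset by blast
    then show "x \<in> B" by (simp add: B_def)
  qed
  have le: "hpre k (d n) B \<le> hausdorff_outer k A + ennreal (d n)" for n
  proof -
    have "(\<lambda>i. closure (C n i)) \<in> hcover (d n) B"
      using bd by (auto simp: hcover_def B_def diameter_closure)
    then have "hpre k (d n) B \<le> (\<Sum>i. hterm k (closure (C n i)))"
      unfolding hpre_def by (rule INF_lower)
    also have "\<dots> = (\<Sum>i. hterm k (C n i))"
      using bd by (simp add: hterm_closure)
    also have "\<dots> \<le> hausdorff_outer k A + ennreal (d n)"
      by (rule order_trans[OF C(2)]) (intro add_right_mono hpre_le_hausdorff_outer d0)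
    finally show ?thesis .
  qed
  have "hausdorff_outer k B \<le> hausdorff_outer k A"
  proof (subst hausdorff_outer_hpre, rule SUP_least, rule ennreal_le_epsilon)
    fix \<delta> e :: real assume \<delta>: "\<delta> \<in> {0<..}" and e: "0 < e"
    obtain n where n: "d n < min \<delta> e"
      using reals_Archimedean[of "min \<delta> e"] \<delta> e unfolding d_def by auto
    have "hpre k \<delta> B \<le> hpre k (d n) B"
      using n by (intro hpre_antimono) auto
    also have "\<dots> \<le> hausdorff_outer k A + ennreal (d n)" by (rule le)
    also have "\<dots> \<le> hausdorff_outer k A + ennreal e"
      using n by (intro add_left_mono ennreal_leI) auto
    finally show "hpre k \<delta> B \<le> hausdorff_outer k A + ennreal e" .
  qed
  then have "hausdorff_outer k B = hausdorff_outer k A"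
    using hausdorff_outer_mono[OF AB] by (rule antisym)
  moreover have "B \<in> sets borel"
    unfolding B_def by (intro sets.countable_INT'' sets.countable_UN) auto
  ultimately show ?thesis using that AB by blast
qed

text \<open>Inner regularity of finite Borel measures applies after \<open>Q\<close> is replaced by
  a Borel subset of equal measure and \<open>Hk k\<close> by its restriction to \<open>Q\<close>,
  pushed to the Borel sets.\<close>

lemma inner_regular_Hk:
  fixes Q :: "'a::euclidean_space set"
  assumes Q: "hmeasurable k Q" and fin: "hausdorff_outer k Q < \<infinity>" and e: "0 < e"
  obtains K where "compact K" "K \<subseteq> Q" "measure (Hk k) Q - e < measure (Hk k) K"
proof -
  let ?H = "Hk k :: 'a measure"
  have Qs: "Q \<in> sets ?H" using Q by (simp add: sets_Hk)
  have bor: "X \<in> sets ?H" if "X \<in> sets borel" for X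
    using borel_subset_Hk that by blast
  have em: "emeasure ?H X = hausdorff_outer k X" if "X \<in> sets ?H" for X
    using that by (simp add: sets_Hk emeasure_Hk)
  obtain B where B: "B \<in> sets borel" "Q \<subseteq> B" "hausdorff_outer k B = hausdorff_outer k Q"
    using borel_regular_Hk[OF fin] .
  have BQ: "emeasure ?H (B - Q) = 0"
    using B fin bor Qs by (subst emeasure_Diff) (auto simp: em)
  then have "hausdorff_outer k (B - Q) = 0"
    using bor[OF B(1)] Qs by (subst em[symmetric]) auto
  then obtain Z where Z: "Z \<in> sets borel" "B - Q \<subseteq> Z" "hausdorff_outer k Z = 0"
    using borel_regular_Hk[of k "B - Q"] by auto
  \<comment> \<open>Cutting a null Borel hull \<open>Z\<close> of \<open>B - Q\<close> out of the
    hull \<open>B\<close> of \<open>Q\<close> leaves a Borel set inside \<open>Q\<close>; what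
    \<open>Q\<close> loses lies in \<open>Z\<close>.\<close>
  let ?G = "B - Z"
  have G: "?G \<in> sets borel" "?G \<subseteq> Q" using B Z by auto
  have "emeasure ?H Q \<le> emeasure ?H (?G \<union> Z)"
    using G Z B bor by (intro emeasure_mono) auto
  also have "\<dots> \<le> emeasure ?H ?G + emeasure ?H Z"
    using G Z bor by (intro emeasure_subadditive) auto
  finally have QG: "emeasure ?H Q = emeasure ?H ?G"
    using Z bor G Qs by (auto simp: em intro!: antisym hausdorff_outer_mono)
  define \<nu> where "\<nu> = distr (restrict_space ?H Q) borel (\<lambda>x. x)"
  have id: "(\<lambda>x. x) \<in> measurable (restrict_space ?H Q) borel"
    by (intro measurable_restrict_space1 measurable_Hk_borel) simp
  have nu: "emeasure \<nu> X = emeasure ?H (X \<inter> Q)" if "X \<in> sets borel" for X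
    unfolding \<nu>_def using that id Qs bor
    by (subst emeasure_distr) (auto simp: space_restrict_space emeasure_restrict_space)
  have "emeasure \<nu> ?G = (SUP K \<in> {K. K \<subseteq> ?G \<and> compact K}. emeasure \<nu> K)"
  proof (rule inner_regular)
    show "sets \<nu> = sets borel" by (simp add: \<nu>_def)
    have "emeasure \<nu> (space \<nu>) = emeasure ?H Q"
      using nu[of UNIV] by (simp add: \<nu>_def)
    then show "emeasure \<nu> (space \<nu>) \<noteq> \<infinity>"
      using fin em[OF Qs] by auto
  qed (use G in auto)
  moreover have "emeasure \<nu> ?G = emeasure ?H Q"
    using G QG nu[of ?G] by (simp add: Int_absorb2)
  ultimately have sup: "emeasure ?H Q = (SUP K \<in> {K. K \<subseteq> ?G \<and> compact K}. emeasure \<nu> K)"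
    by simp
  have finQ: "emeasure ?H Q \<noteq> \<infinity>" using fin em[OF Qs] by auto
  \<comment> \<open>If \<open>Q\<close> is null, the truncated difference with \<open>e\<close> is
    not strictly below the measure; the empty compact set serves instead.\<close>
  show ?thesis
  proof (cases "emeasure ?H Q = 0")
    case True
    then show ?thesis
      using that[of "{}"] e by (simp add: measure_def)
  next
    case False
    then have "emeasure ?H Q - ennreal e < emeasure ?H Q"
      using e finQ by (intro ennreal_between) (auto simp: less_top zero_less_iff_neq_zero)
    then obtain K where K: "K \<subseteq> ?G" "compact K" "emeasure ?H Q - ennreal e < emeasure \<nu> K"
      unfolding sup less_SUP_iff by (auto simp: sup[symmetric])
    have KQ: "K \<subseteq> Q" using K G by auto
    have Ks: "K \<in> sets borel" using K(2) by (intro borel_compact)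
    have eK: "emeasure \<nu> K = emeasure ?H K"
      using KQ Ks nu[of K] by (simp add: Int_absorb2)
    have finK: "emeasure ?H K \<noteq> \<infinity>"
      using finQ emeasure_mono[OF KQ Qs] by (auto simp: top_unique)
    have "ennreal (measure ?H Q) - ennreal e < ennreal (measure ?H K)"
      using K(3) finQ finK unfolding eK by (simp add: emeasure_eq_ennreal_measure)
    then have "measure ?H Q - e < measure ?H K"
      using e by (subst (asm) ennreal_minus) (auto simp: not_le[symmetric] dest: ennreal_leI)
    then show ?thesis using that K(2) KQ by blast
  qed
qed

subsection \<open>Forms and averaging currents\<close>

text \<open>Membership in \<open>D0\<close> controls a form only on constant lists of vectors.
  Expanding a slot over the basis reduces arguments that vary with the point to constant
  ones.\<close>

lemma kcovector_expand_slot: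
  assumes \<phi>: "kcovector k \<phi>" and k: "length us + length vs + 1 = k"
  shows "\<phi> (us @ v # vs) = (\<Sum>b\<in>Basis. (v \<bullet> b) * \<phi> (us @ b # vs))"
proof -
  have lin: "linear (\<lambda>v. \<phi> (us @ v # vs))"
    using \<phi>[unfolded kcovector_def, THEN conjunct2, THEN conjunct1, rule_format, of "us @ 0 # vs" "length us"] k
    by (simp add: list_update_append)
  have "\<phi> (us @ v # vs) = \<phi> (us @ (\<Sum>b\<in>Basis. (v \<bullet> b) *\<^sub>R b) # vs)"
    by (simp add: euclidean_representation)
  also have "\<dots> = (\<Sum>b\<in>Basis. (v \<bullet> b) * \<phi> (us @ b # vs))"
    using linear_sum[OF lin, of "\<lambda>b. (v \<bullet> b) *\<^sub>R b" Basis] linear_cmul[OF lin] by simp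
  finally show ?thesis .
qed

definition orthoframe :: "nat \<Rightarrow> (nat \<Rightarrow> 'a::euclidean_space) \<Rightarrow> bool" where
  "orthoframe k t \<longleftrightarrow> (\<forall>i<k. \<forall>j<k. t i \<bullet> t j = (if i = j then 1 else 0))"

definition comass_le :: "nat \<Rightarrow> 'a::euclidean_space set \<Rightarrow> real \<Rightarrow> 'a kform \<Rightarrow> bool" where
  "comass_le k E c \<omega> \<longleftrightarrow> (\<forall>x\<in>E. \<forall>t. orthoframe k t \<longrightarrow> \<bar>\<omega> x (map t [0..<k])\<bar> \<le> c)"

text \<open>The data of an averaging current, without tangency of the frame and rectifiability.\<close>
definition framed :: "nat \<Rightarrow> 'a::euclidean_space set \<Rightarrow> 'a set \<Rightarrow> ('a \<Rightarrow> real) \<Rightarrow> (nat \<Rightarrow> 'a \<Rightarrow> 'a) \<Rightarrow> bool" where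
  "framed k E S \<sigma> \<tau> \<longleftrightarrow> S \<subseteq> E \<and> hmeasurable k S \<and> hausdorff_outer k S < \<infinity> \<and>
     (\<forall>x\<in>S. (\<sigma> x = 1 \<or> \<sigma> x = -1) \<and> orthoframe k (\<lambda>i. \<tau> i x)) \<and>
     \<sigma> \<in> borel_measurable (restrict_space (Hk k) S) \<and>
     (\<forall>i<k. \<tau> i \<in> borel_measurable (restrict_space (Hk k) S))"

lemma norm_orthoframe: "orthoframe k t \<Longrightarrow> i < k \<Longrightarrow> norm (t i) = 1"
  by (simp add: orthoframe_def norm_eq_1)

section \<open>Measurability and boundedness of a form along a moving frame\<close>

lemma D0_kcovector: "\<omega> \<in> D0 k E \<Longrightarrow> kcovector k (\<omega> x)"
  by (cases "x \<in> E") (auto simp: D0_def kcovector_def linear_0 linear_zero intro: linear_zero)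

lemma D0_borel_measurable:
  assumes "\<omega> \<in> D0 k E" "closed E"
  shows "(\<lambda>x. \<omega> x vs) \<in> borel_measurable borel"
proof -
  have "(\<lambda>x. indicator E x *\<^sub>R \<omega> x vs) \<in> borel_measurable borel"
    using assms by (intro borel_measurable_continuous_on_indicator) (auto simp: D0_def)
  moreover have "(\<lambda>x. indicator E x *\<^sub>R \<omega> x vs) = (\<lambda>x. \<omega> x vs)"
    using assms by (auto simp: D0_def indicator_def fun_eq_iff)
  ultimately show ?thesis by simp
qed

text \<open>Induction on the number \<open>m\<close> of slots filled by the moving frame: expansion
  of the last of them shifts its dependence on \<open>x\<close> into the measurable coefficients
  \<open>\<tau> m x \<bullet> b\<close>.\<close>

lemma kform_frame_measurable:
  assumes "\<And>vs. (\<lambda>x. \<omega> x vs) \<in> borel_measurable N"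
    and "\<And>x. kcovector k (\<omega> x)"
    and "\<And>i. i < k \<Longrightarrow> \<tau> i \<in> borel_measurable N"
    and "m \<le> k" "length us = k - m"
  shows "(\<lambda>x. \<omega> x (map (\<lambda>i. \<tau> i x) [0..<m] @ us)) \<in> borel_measurable N"
  using assms(4,5)
proof (induction m arbitrary: us)
  case 0
  then show ?case using assms(1) by simp
next
  case (Suc m)
  have eq: "\<omega> x (map (\<lambda>i. \<tau> i x) [0..<Suc m] @ us)
      = (\<Sum>b\<in>Basis. (\<tau> m x \<bullet> b) * \<omega> x (map (\<lambda>i. \<tau> i x) [0..<m] @ b # us))" for x
    using kcovector_expand_slot[OF assms(2)[of x], of "map (\<lambda>i. \<tau> i x) [0..<m]" us "\<tau> m x"] Suc.prems
    by simp
  have "(\<lambda>x. \<omega> x (map (\<lambda>i. \<tau> i x) [0..<m] @ b # us)) \<in> borel_measurable N" for b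
    using Suc.prems by (intro Suc.IH) auto
  moreover have "\<tau> m \<in> borel_measurable N"
    using Suc.prems by (intro assms(3)) auto
  ultimately show ?case
    unfolding eq by (intro borel_measurable_sum borel_measurable_times borel_measurable_inner) auto
qed

text \<open>The same slot-by-slot expansion; once all slots are constant, continuity on the compact
  \<open>E\<close> gives a bound. Coordinates of vectors of norm at most 1 are at most 1, hence a
  sum of constants over the basis.\<close>

lemma D0_bounded:
  assumes \<omega>: "\<omega> \<in> D0 k E" and E: "compact E"
  obtains C where "0 \<le> C" "\<And>x t. orthoframe k t \<Longrightarrow> \<bar>\<omega> x (map t [0..<k])\<bar> \<le> C"
proof -
  have "\<exists>C. \<forall>x vs. length vs = m \<longrightarrow> (\<forall>v\<in>set vs. norm v \<le> 1) \<longrightarrow> \<bar>\<omega> x (vs @ us)\<bar> \<le> C"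
    if "m \<le> k" "length us = k - m" for m us
    using that
  proof (induction m arbitrary: us)
    case 0
    have "compact ((\<lambda>x. \<omega> x us) ` E)"
      using \<omega> E by (intro compact_continuous_image) (auto simp: D0_def)
    then have "bounded ((\<lambda>x. \<omega> x us) ` E)"
      by (rule compact_imp_bounded)
    then obtain C where "\<forall>x\<in>E. \<bar>\<omega> x us\<bar> \<le> C"
      by (auto simp: bounded_iff)
    then have C: "x \<in> E \<Longrightarrow> \<bar>\<omega> x us\<bar> \<le> C" for x by blast
    \<comment> \<open>The maximum with 0 covers the points outside \<open>E\<close>, where the form
      vanishes and \<open>C\<close> gives no information.\<close>
    have "\<bar>\<omega> x us\<bar> \<le> max C 0" for x
      using C[of x] \<omega> by (cases "x \<in> E") (auto simp: D0_def)
    then show ?case by auto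
  next
    case (Suc m)
    have "\<exists>C. \<forall>x vs. length vs = m \<longrightarrow> (\<forall>v\<in>set vs. norm v \<le> 1) \<longrightarrow> \<bar>\<omega> x (vs @ b # us)\<bar> \<le> C" for b
      using Suc.prems by (intro Suc.IH) auto
    then obtain C where C: "\<And>b x vs. length vs = m \<Longrightarrow> (\<forall>v\<in>set vs. norm v \<le> 1) \<Longrightarrow>
        \<bar>\<omega> x (vs @ b # us)\<bar> \<le> C b"
      by metis
    have "\<bar>\<omega> x (vs @ us)\<bar> \<le> (\<Sum>b\<in>Basis. C b)"
      if vs: "length vs = Suc m" "\<forall>v\<in>set vs. norm v \<le> 1" for x vs
    proof -
      obtain vs' v where v: "vs = vs' @ [v]" "length vs' = m"
        using vs(1) by (metis append_butlast_last_id length_append_singleton length_greater_0_conv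
            nat.inject zero_less_Suc)
      have "\<omega> x (vs @ us) = (\<Sum>b\<in>Basis. (v \<bullet> b) * \<omega> x (vs' @ b # us))"
        using kcovector_expand_slot[OF D0_kcovector[OF \<omega>], of vs' us x v] v Suc.prems by simp
      also have "\<bar>\<dots>\<bar> \<le> (\<Sum>b\<in>Basis. 1 * C b)"
      proof (rule order_trans[OF sum_abs sum_mono])
        fix b :: 'a assume b: "b \<in> Basis"
        have "\<bar>v \<bullet> b\<bar> \<le> 1"
          using Basis_le_norm[OF b, of v] vs(2) v by auto
        moreover have "\<bar>\<omega> x (vs' @ b # us)\<bar> \<le> C b"
          using C vs v by simp
        ultimately show "\<bar>(v \<bullet> b) * \<omega> x (vs' @ b # us)\<bar> \<le> 1 * C b"
          unfolding abs_mult by (intro mult_mono) auto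
      qed
      finally show ?thesis by simp
    qed
    then show ?case by blast
  qed
  from this[of k "[]"] obtain C where
    C: "\<And>x vs. length vs = k \<Longrightarrow> (\<forall>v\<in>set vs. norm v \<le> 1) \<Longrightarrow> \<bar>\<omega> x vs\<bar> \<le> C"
    by auto
  show ?thesis
  proof (rule that[of "max C 0"])
    fix x and t :: "nat \<Rightarrow> 'a" assume t: "orthoframe k t"
    have "\<bar>\<omega> x (map t [0..<k])\<bar> \<le> C"
      by (rule C) (auto simp: norm_orthoframe[OF t])
    then show "\<bar>\<omega> x (map t [0..<k])\<bar> \<le> max C 0" by simp
  qed simp
qed

lemma framed_subset:
  assumes "framed k E S \<sigma> \<tau>" "S' \<subseteq> S" "hmeasurable k S'"
  shows "framed k E S' \<sigma> \<tau>"
proof -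
  have "\<sigma> \<in> borel_measurable (restrict_space (Hk k) S')"
    "\<forall>i<k. \<tau> i \<in> borel_measurable (restrict_space (Hk k) S')"
    using assms(1) by (auto simp: framed_def intro!: measurable_restrict_mono[OF _ assms(2)])
  moreover have "hausdorff_outer k S' < \<infinity>"
    using assms hausdorff_outer_mono[of S' S k] by (auto simp: framed_def intro: le_less_trans)
  moreover have "S' \<subseteq> E" "\<forall>x\<in>S'. (\<sigma> x = 1 \<or> \<sigma> x = -1) \<and> orthoframe k (\<lambda>i. \<tau> i x)"
    using assms unfolding framed_def by auto
  ultimately show ?thesis
    using assms(1,3) unfolding framed_def by simp
qed

lemma framed_sets: "framed k E S \<sigma> \<tau> \<Longrightarrow> S \<in> sets (Hk k)"
  by (simp add: framed_def sets_Hk)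

lemma framed_emeasure: "framed k E S \<sigma> \<tau> \<Longrightarrow> emeasure (Hk k) S < \<infinity>"
  by (simp add: framed_def emeasure_Hk)

lemma kpair_measurable:
  assumes "framed k E S \<sigma> \<tau>" "\<omega> \<in> D0 k E" "closed E"
  shows "kpair k \<omega> \<sigma> \<tau> \<in> borel_measurable (restrict_space (Hk k) S)"
proof -
  let ?N = "restrict_space (Hk k) S"
  have "(\<lambda>x. \<omega> x (map (\<lambda>i. \<tau> i x) [0..<k] @ [])) \<in> borel_measurable ?N"
  proof (rule kform_frame_measurable)
    show "(\<lambda>x. \<omega> x vs) \<in> borel_measurable ?N" for vs
      using assms by (intro measurable_restrict_space1 measurable_Hk_borel D0_borel_measurable)
    show "kcovector k (\<omega> x)" for x using assms by (intro D0_kcovector)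
    show "\<tau> i \<in> borel_measurable ?N" if "i < k" for i
      using assms that by (simp add: framed_def)
  qed simp_all
  then show ?thesis
    using assms(1) unfolding kpair_def framed_def by auto
qed

lemma kpair_comass:
  assumes "framed k E S \<sigma> \<tau>" "comass_le k E c \<omega>" "x \<in> S"
  shows "\<bar>kpair k \<omega> \<sigma> \<tau> x\<bar> \<le> c"
proof -
  have "\<bar>\<omega> x (map (\<lambda>i. \<tau> i x) [0..<k])\<bar> \<le> c" "\<bar>\<sigma> x\<bar> = 1"
    using assms by (auto simp: framed_def comass_le_def)
  then show ?thesis by (simp add: kpair_def abs_mult)
qed

lemma D0_comass:
  assumes "\<omega> \<in> D0 k E" "compact E"
  obtains c where "0 \<le> c" "comass_le k E c \<omega>"
  using D0_bounded[OF assms] unfolding comass_le_def by metis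

lemma kpair_integrable:
  assumes fr: "framed k E S \<sigma> \<tau>" and \<omega>: "\<omega> \<in> D0 k E" and E: "compact E"
  shows "set_integrable (Hk k) S (kpair k \<omega> \<sigma> \<tau>)"
proof -
  obtain c where c: "comass_le k E c \<omega>" using D0_comass[OF \<omega> E] by blast
  have S: "S \<in> sets (Hk k)" by (rule framed_sets[OF fr])
  have "integrable (Hk k) (\<lambda>x. c * indicator S x :: real)"
    using S framed_emeasure[OF fr] by simp
  then show ?thesis
    unfolding set_integrable_def
  proof (rule Bochner_Integration.integrable_bound)
    show "(\<lambda>x. indicator S x *\<^sub>R kpair k \<omega> \<sigma> \<tau> x) \<in> borel_measurable (Hk k)"
      using kpair_measurable[OF fr \<omega> compact_imp_closed[OF E]] S
      by (subst (asm) borel_measurable_restrict_space_iff) (auto simp: mult.commute)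
    show "AE x in Hk k. norm (indicator S x *\<^sub>R kpair k \<omega> \<sigma> \<tau> x) \<le> norm (c * indicator S x)"
      using kpair_comass[OF fr c] by (intro AE_I2) (fastforce simp: indicator_def)
  qed
qed

section \<open>Averaging currents as bounded linear functionals\<close>

lemma avg_current_linear:
  assumes fr: "framed k E S \<sigma> \<tau>" and \<omega>: "\<omega> \<in> D0 k E" and \<theta>: "\<theta> \<in> D0 k E" and E: "compact E"
  shows "avg_current k S \<sigma> \<tau> (\<lambda>x vs. a * \<omega> x vs + \<theta> x vs)
    = a * avg_current k S \<sigma> \<tau> \<omega> + avg_current k S \<sigma> \<tau> \<theta>"
proof -
  have "kpair k (\<lambda>x vs. a * \<omega> x vs + \<theta> x vs) \<sigma> \<tau> = (\<lambda>x. a * kpair k \<omega> \<sigma> \<tau> x + kpair k \<theta> \<sigma> \<tau> x)"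
    by (auto simp: kpair_def algebra_simps)
  moreover have "(LINT x:S|Hk k. a * kpair k \<omega> \<sigma> \<tau> x + kpair k \<theta> \<sigma> \<tau> x)
      = a * (LINT x:S|Hk k. kpair k \<omega> \<sigma> \<tau> x) + (LINT x:S|Hk k. kpair k \<theta> \<sigma> \<tau> x)"
    using kpair_integrable[OF fr _ E] \<omega> \<theta> by (subst set_integral_add) auto
  ultimately show ?thesis
    unfolding avg_current_def by (simp add: add_divide_distrib)
qed

lemma avg_current_bound:
  assumes fr: "framed k E S \<sigma> \<tau>" and pos: "0 < measure (Hk k) S"
    and \<omega>: "\<omega> \<in> D0 k E" and c: "comass_le k E c \<omega>" and E: "compact E"
  shows "\<bar>avg_current k S \<sigma> \<tau> \<omega>\<bar> \<le> c"
proof -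
  have S: "S \<in> sets (Hk k)" by (rule framed_sets[OF fr])
  have "\<bar>LINT x:S|Hk k. kpair k \<omega> \<sigma> \<tau> x\<bar> \<le> (LINT x:S|Hk k. norm (kpair k \<omega> \<sigma> \<tau> x))"
    using set_integral_norm_bound[OF kpair_integrable[OF fr \<omega> E]] by simp
  also have "\<dots> \<le> (LINT x:S|Hk k. c)"
  proof (rule set_integral_mono)
    show "set_integrable (Hk k) S (\<lambda>x. norm (kpair k \<omega> \<sigma> \<tau> x))"
      by (intro set_integrable_norm kpair_integrable[OF fr \<omega> E])
    show "set_integrable (Hk k) S (\<lambda>x. c)"
      using S framed_emeasure[OF fr] by (simp add: set_integrable_def)
  qed (use kpair_comass[OF fr c] in auto)
  also have "\<dots> = c * measure (Hk k) S"
    using S framed_emeasure[OF fr] by (simp add: set_lebesgue_integral_def)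
  finally show ?thesis
    using pos by (simp add: avg_current_def divide_le_eq)
qed

lemma Ak_framed:
  assumes "T \<in> Ak k E"
  obtains S \<sigma> \<tau> where "T = avg_current k S \<sigma> \<tau>" "framed k E S \<sigma> \<tau>" "0 < measure (Hk k) S"
proof -
  obtain S \<sigma> \<tau> where *: "T = avg_current k S \<sigma> \<tau>" "S \<subseteq> E" "hmeasurable k S"
      "0 < hausdorff_outer k S" "hausdorff_outer k S < \<infinity>" "orientation k S \<sigma> \<tau>"
    using assms unfolding Ak_def by blast
  then have "framed k E S \<sigma> \<tau>"
    by (auto simp: framed_def orientation_def orthoframe_def)
  moreover have "0 < measure (Hk k) S"
    using * by (simp add: measure_def emeasure_Hk enn2real_positive_iff)
  ultimately show ?thesis using that * by blast
qed

lemma Ak_linear: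
  assumes "T \<in> Ak k E" "compact E" "\<omega> \<in> D0 k E" "\<theta> \<in> D0 k E"
  shows "T (\<lambda>x vs. a * \<omega> x vs + \<theta> x vs) = a * T \<omega> + T \<theta>"
  by (rule Ak_framed[OF assms(1)]) (simp add: avg_current_linear[OF _ assms(3,4,2)])

lemma Ak_bound:
  assumes "T \<in> Ak k E" "compact E" "\<omega> \<in> D0 k E" "comass_le k E c \<omega>"
  shows "\<bar>T \<omega>\<bar> \<le> c"
  by (rule Ak_framed[OF assms(1)]) (simp add: avg_current_bound[OF _ _ assms(3,4,2)])

text \<open>A real \<open>Sup\<close> has its meaning only on bounded sets; this makes
  \<open>norm0\<close> a true upper bound.\<close>

lemma Ak_bdd:
  assumes "compact E" "\<omega> \<in> D0 k E"
  shows "bdd_above ((\<lambda>T. \<bar>T \<omega>\<bar>) ` Ak k E)"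
proof -
  obtain c where c: "comass_le k E c \<omega>" using D0_comass[OF assms(2,1)] by blast
  show ?thesis by (rule bdd_aboveI2) (rule Ak_bound[OF _ assms c])
qed

lemma Ak_le_norm0:
  assumes "T \<in> Ak k E" "compact E" "\<omega> \<in> D0 k E"
  shows "\<bar>T \<omega>\<bar> \<le> norm0 k E \<omega>"
  unfolding norm0_def by (rule cSUP_upper[OF assms(1) Ak_bdd[OF assms(2,3)]])

lemma D0_zero: "(\<lambda>x vs. 0) \<in> D0 k E"
  by (auto simp: D0_def kcovector_def linear_zero)

lemma D0_linear:
  assumes "\<omega> \<in> D0 k E" "\<theta> \<in> D0 k E"
  shows "(\<lambda>x vs. a * \<omega> x vs + \<theta> x vs) \<in> D0 k E"
proof -
  have lin: "linear (\<lambda>v. a * f v + g v)" if "linear f" "linear g" for f g :: "'a \<Rightarrow> real"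
    using that by (simp add: linear_iff algebra_simps)
  have "kcovector k (\<lambda>vs. a * \<omega> x vs + \<theta> x vs)" for x
    using D0_kcovector[OF assms(1), of x] D0_kcovector[OF assms(2), of x]
    unfolding kcovector_def
    by (auto intro!: lin)
  then show ?thesis
    using assms by (auto simp: D0_def intro!: continuous_intros)
qed

subsection \<open>Determinant forms have comass at most 1\<close>

text \<open>The wedge product of the covectors dual to \<open>t 0\<close>, ...,
  \<open>t (k-1)\<close>. The value 0 on lists of other length is what \<open>kcovector\<close>
  demands.\<close>

definition det_form :: "nat \<Rightarrow> (nat \<Rightarrow> 'a::euclidean_space) \<Rightarrow> 'a list \<Rightarrow> real" where
  "det_form k t vs = (if length vs = k then Determinant.det (mat k k (\<lambda>(i, j). vs ! i \<bullet> t j)) else 0)"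

lemma det_form_leibniz:
  assumes "length vs = k"
  shows "det_form k t vs =
    (\<Sum>p | p permutes {0..<k}. signof p * (\<Prod>i = 0..<k. vs ! i \<bullet> t (p i)))"
proof -
  have "(\<Prod>i = 0..<k. mat k k (\<lambda>(i, j). vs ! i \<bullet> t j) $$ (i, p i)) = (\<Prod>i = 0..<k. vs ! i \<bullet> t (p i))"
    if "p permutes {0..<k}" for p
    using permutes_in_image[OF that] by (intro prod.cong) auto
  then show ?thesis
    using assms unfolding det_form_def by (subst det_def') auto
qed

lemma kcovector_det_form: "kcovector k (det_form k t)"
  unfolding kcovector_def
proof (intro conjI allI impI)
  fix vs :: "'a list" assume "length vs \<noteq> k"
  then show "det_form k t vs = 0" by (simp add: det_form_def)
next
  fix vs :: "'a list" and i assume "length vs = k \<and> i < k"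
  then have l: "length vs = k" and i: "i < k" by auto
  \<comment> \<open>Slot \<open>i\<close> enters each Leibniz product through a single factor,
    whence linearity in it.\<close>
  have eq: "(\<Prod>j = 0..<k. vs[i := v] ! j \<bullet> t (p j))
      = (v \<bullet> t (p i)) * (\<Prod>j \<in> {0..<k} - {i}. vs ! j \<bullet> t (p j))" for v p
    using l i by (subst prod.remove[of _ i]) (auto intro!: prod.cong)
  show "linear (\<lambda>v. det_form k t (vs[i := v]))"
    by (simp add: det_form_leibniz l eq linear_iff inner_add_left algebra_simps sum.distrib sum_distrib_left)
next
  fix vs :: "'a list" and i j assume *: "length vs = k \<and> i < j \<and> j < k \<and> vs ! i = vs ! j"
  have "Determinant.det (mat k k (\<lambda>(i, j). vs ! i \<bullet> t j)) = 0"
    by (rule det_identical_rows[of _ k i j]) (use * in auto)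
  then show "det_form k t vs = 0" by (simp add: det_form_def)
qed

section \<open>Determinants of contractions and orthonormal frames\<close>

lemma abs_det_le_fact:
  fixes A :: "real mat"
  assumes A: "A \<in> carrier_mat k k" and le: "\<And>i j. i < k \<Longrightarrow> j < k \<Longrightarrow> \<bar>A $$ (i, j)\<bar> \<le> 1"
  shows "\<bar>Determinant.det A\<bar> \<le> fact k"
proof -
  have "\<bar>signof p * (\<Prod>i = 0..<k. A $$ (i, p i))\<bar> \<le> (1::real)" if "p permutes {0..<k}" for p
  proof -
    have "\<bar>\<Prod>i = 0..<k. A $$ (i, p i)\<bar> \<le> 1"
      unfolding abs_prod using permutes_in_image[OF that] by (intro prod_le_1) (auto intro: le)
    then show ?thesis by (simp add: abs_mult sign_def)
  qed
  then have "\<bar>Determinant.det A\<bar> \<le> (\<Sum>p | p permutes {0..<k}. 1)"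
    unfolding det_def'[OF A] by (intro order_trans[OF sum_abs sum_mono]) auto
  also have "\<dots> = fact k"
    by (simp add: card_permutations[of "{0..<k}" k])
  finally show ?thesis .
qed

text \<open>The powers of a contraction have entries at most 1, so \<open>\<bar>det A\<bar> ^ n \<le> k!\<close> for all \<open>n\<close>.\<close>
lemma abs_det_contraction_le_1:
  fixes A :: "real mat"
  assumes A: "A \<in> carrier_mat k k"
    and contr: "\<And>x. (\<Sum>i<k. (\<Sum>j<k. A $$ (i, j) * x j)\<^sup>2) \<le> (\<Sum>j<k. (x j)\<^sup>2)"
  shows "\<bar>Determinant.det A\<bar> \<le> 1"
proof (rule ccontr)
  assume "\<not> ?thesis"
  then obtain n where n: "fact k < \<bar>Determinant.det A\<bar> ^ n"
    using real_arch_pow[of "\<bar>Determinant.det A\<bar>" "fact k"] by auto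
  define B where "B n = ((\<lambda>X. A * X) ^^ n) (1\<^sub>m k)" for n
  have B: "B n \<in> carrier_mat k k" for n
    by (induction n) (use A in \<open>auto simp: B_def\<close>)
  have detB: "Determinant.det (B n) = Determinant.det A ^ n" for n
  proof (induction n)
    case (Suc n)
    have "B (Suc n) = A * B n" by (simp add: B_def)
    then show ?case using det_mult[OF A B[of n]] Suc by simp
  qed (simp add: B_def)
  \<comment> \<open>Columns of the powers are images of unit coordinate vectors under repeated
    contraction, so their Euclidean length stays at most 1.\<close>
  have col: "(\<Sum>i<k. (B n $$ (i, j))\<^sup>2) \<le> 1" if j: "j < k" for n j
  proof (induction n)
    case 0
    have "(\<Sum>i<k. (B 0 $$ (i, j))\<^sup>2) = (\<Sum>i<k. if i = j then 1 else 0)"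
      using j by (intro sum.cong) (auto simp: B_def)
    then show ?case using j by simp
  next
    case (Suc n)
    have "B (Suc n) $$ (i, j) = (\<Sum>l<k. A $$ (i, l) * B n $$ (l, j))" if "i < k" for i
      using A B[of n] j that by (simp add: B_def scalar_prod_def atLeast0LessThan)
    then have "(\<Sum>i<k. (B (Suc n) $$ (i, j))\<^sup>2) = (\<Sum>i<k. (\<Sum>l<k. A $$ (i, l) * B n $$ (l, j))\<^sup>2)"
      by (intro sum.cong) auto
    also have "\<dots> \<le> (\<Sum>l<k. (B n $$ (l, j))\<^sup>2)" by (rule contr)
    finally show ?case using Suc by simp
  qed
  have "\<bar>B n $$ (i, j)\<bar> \<le> 1" if "i < k" "j < k" for i j
  proof -
    have "(B n $$ (i, j))\<^sup>2 \<le> (\<Sum>i<k. (B n $$ (i, j))\<^sup>2)"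
      using that by (intro member_le_sum) auto
    then show ?thesis
      using col[OF that(2), of n] abs_square_le_1 order_trans by blast
  qed
  then have "\<bar>Determinant.det (B n)\<bar> \<le> fact k"
    by (rule abs_det_le_fact[OF B])
  then show False using n by (simp add: detB power_abs)
qed

lemma orthoframe_inner_sum:
  assumes "orthoframe k t" "i < k"
  shows "t i \<bullet> (\<Sum>j<k. c j *\<^sub>R t j) = c i"
proof -
  have "t i \<bullet> (\<Sum>j<k. c j *\<^sub>R t j) = (\<Sum>j<k. if i = j then c j else 0)"
    unfolding inner_sum_right using assms by (intro sum.cong) (auto simp: orthoframe_def)
  then show ?thesis using assms(2) by simp
qed

lemma orthoframe_norm_sum:
  assumes "orthoframe k t"
  shows "(\<Sum>j<k. c j *\<^sub>R t j) \<bullet> (\<Sum>j<k. c j *\<^sub>R t j) = (\<Sum>j<k. (c j)\<^sup>2)"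
  by (subst inner_sum_left) (simp add: orthoframe_inner_sum[OF assms] power2_eq_square)

lemma orthoframe_bessel:
  assumes "orthoframe k t"
  shows "(\<Sum>i<k. (t i \<bullet> y)\<^sup>2) \<le> y \<bullet> y"
proof -
  let ?p = "\<Sum>i<k. (t i \<bullet> y) *\<^sub>R t i"
  have "y \<bullet> ?p = (\<Sum>i<k. (t i \<bullet> y)\<^sup>2)"
    by (simp add: inner_sum_right power2_eq_square inner_commute)
  moreover have "0 \<le> (y - ?p) \<bullet> (y - ?p)" by simp
  ultimately show ?thesis
    using orthoframe_norm_sum[OF assms, of "\<lambda>i. t i \<bullet> y"]
    by (simp add: inner_diff_left inner_diff_right inner_commute)
qed

text \<open>The matrix sends \<open>x\<close> to the inner products of the \<open>v i\<close> with
  the vector whose coordinates in the frame \<open>t\<close> are \<open>x\<close>. Building that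
  vector is isometric and Bessel's inequality controls the products, so the matrix is a
  contraction.\<close>

lemma det_form_comass:
  assumes t: "orthoframe k t" and v: "orthoframe k v"
  shows "\<bar>det_form k t (map v [0..<k])\<bar> \<le> 1"
proof -
  let ?A = "mat k k (\<lambda>(i, j). map v [0..<k] ! i \<bullet> t j)"
  have "\<bar>Determinant.det ?A\<bar> \<le> 1"
  proof (rule abs_det_contraction_le_1[of _ k])
    fix x :: "nat \<Rightarrow> real"
    define y where "y = (\<Sum>j<k. x j *\<^sub>R t j)"
    have "(\<Sum>j<k. ?A $$ (i, j) * x j) = v i \<bullet> y" if "i < k" for i
      using that by (simp add: y_def inner_sum_right mult.commute)
    then have "(\<Sum>i<k. (\<Sum>j<k. ?A $$ (i, j) * x j)\<^sup>2) = (\<Sum>i<k. (v i \<bullet> y)\<^sup>2)"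
      by (intro sum.cong) auto
    also have "\<dots> \<le> y \<bullet> y" by (rule orthoframe_bessel[OF v])
    also have "\<dots> = (\<Sum>j<k. (x j)\<^sup>2)"
      unfolding y_def by (rule orthoframe_norm_sum[OF t])
    finally show "(\<Sum>i<k. (\<Sum>j<k. ?A $$ (i, j) * x j)\<^sup>2) \<le> (\<Sum>j<k. (x j)\<^sup>2)" .
  qed simp
  then show ?thesis by (simp add: det_form_def)
qed

lemma det_form_self:
  assumes "orthoframe k t"
  shows "det_form k t (map t [0..<k]) = 1"
proof -
  have "mat k k (\<lambda>(i, j). map t [0..<k] ! i \<bullet> t j) = 1\<^sub>m k"
    using assms by (intro eq_matI) (auto simp: orthoframe_def)
  then show ?thesis by (simp add: det_form_def)
qed

text \<open>Each of the \<open>k!\<close> Leibniz products has \<open>k\<close> factors of modulus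
  at most 1, and passing from \<open>t\<close> to \<open>v\<close> moves a factor by at most
  \<open>d\<close>. Such products differ by at most the sum of the changes of their factors, hence
  the constant.\<close>

lemma det_form_close:
  assumes t: "orthoframe k t" and v: "orthoframe k v" and d: "\<And>i. i < k \<Longrightarrow> norm (v i - t i) \<le> d"
  shows "1 - fact k * (real k * d) \<le> det_form k t (map v [0..<k])"
proof -
  let ?P = "{p. p permutes {0..<k}}"
  have inner1: "\<bar>u i \<bullet> t j\<bar> \<le> 1" if "orthoframe k u" "i < k" "j < k" for u i j
    using Cauchy_Schwarz_ineq2[of "u i" "t j"] norm_orthoframe[OF that(1,2)] norm_orthoframe[OF t that(3)]
    by simp
  have "\<bar>det_form k t (map v [0..<k]) - det_form k t (map t [0..<k])\<bar> \<le> (\<Sum>p\<in>?P. real k * d)"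
  proof -
    have "\<bar>signof p * (\<Prod>i = 0..<k. v i \<bullet> t (p i)) - signof p * (\<Prod>i = 0..<k. t i \<bullet> t (p i))\<bar> \<le> real k * d"
      if p: "p \<in> ?P" for p
    proof -
      have pk: "p i < k" if "i < k" for i
        using permutes_in_image[of p "{0..<k}" i] p that by auto
      have "\<bar>(\<Prod>i = 0..<k. v i \<bullet> t (p i)) - (\<Prod>i = 0..<k. t i \<bullet> t (p i))\<bar>
          \<le> (\<Sum>i = 0..<k. \<bar>v i \<bullet> t (p i) - t i \<bullet> t (p i)\<bar>)"
        using norm_prod_diff[of "{0..<k}" "\<lambda>i. v i \<bullet> t (p i)" "\<lambda>i. t i \<bullet> t (p i)"]
          inner1[OF v] inner1[OF t] pk by auto
      also have "\<dots> \<le> (\<Sum>i = 0..<k. d)"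
      proof (rule sum_mono)
        fix i assume "i \<in> {0..<k}"
        then have i: "i < k" by simp
        have "\<bar>(v i - t i) \<bullet> t (p i)\<bar> \<le> norm (v i - t i) * norm (t (p i))"
          by (rule Cauchy_Schwarz_ineq2)
        then show "\<bar>v i \<bullet> t (p i) - t i \<bullet> t (p i)\<bar> \<le> d"
          using norm_orthoframe[OF t pk[OF i]] d[OF i] by (simp add: inner_diff_left)
      qed
      finally show ?thesis
        by (auto simp: sign_def right_diff_distrib[symmetric] abs_mult)
    qed
    then show ?thesis
      by (simp add: det_form_leibniz sum_subtractf[symmetric])
         (rule order_trans[OF sum_abs sum_bounded_above], simp)
  qed
  also have "\<dots> = fact k * (real k * d)"
    by (simp add: card_permutations[of "{0..<k}" k])
  finally show ?thesis
    unfolding det_form_self[OF t] by linarith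
qed

subsection \<open>Forms almost dual to given frames\<close>

text \<open>Frame vectors lie on the compact unit sphere, which has a finite net \<open>F\<close> of
  radius \<delta>/2. Points are sorted by their sign and by the net points near each frame vector;
  sharing a net point forces distance below \<delta>.\<close>

lemma framed_finite_partition:
  fixes \<tau> :: "nat \<Rightarrow> 'a::euclidean_space \<Rightarrow> 'a"
  assumes fr: "framed k E Q \<sigma> \<tau>" and \<delta>: "0 < \<delta>"
  obtains \<P> where "finite \<P>" "\<Union>\<P> = Q" "disjoint \<P>" "\<And>R. R \<in> \<P> \<Longrightarrow> hmeasurable k R"
    "\<And>R x y i. R \<in> \<P> \<Longrightarrow> x \<in> R \<Longrightarrow> y \<in> R \<Longrightarrow> \<sigma> x = \<sigma> y \<and> (i < k \<longrightarrow> norm (\<tau> i x - \<tau> i y) \<le> \<delta>)"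
proof -
  obtain F where F: "finite F" "sphere 0 1 \<subseteq> (\<Union>c\<in>F. ball c (\<delta>/2) :: 'a set)"
  proof -
    have "sphere 0 1 \<subseteq> (\<Union>c\<in>sphere 0 1. ball c (\<delta>/2) :: 'a set)"
      using \<delta> by (auto simp: subset_iff intro!: bexI[where x="_"])
    then show ?thesis
      using compactE_image[of "sphere 0 1" "sphere 0 1" "\<lambda>c::'a. ball c (\<delta>/2)"] that
      by (metis compact_sphere open_ball)
  qed
  \<comment> \<open>Recording all near net points avoids choosing one, so that the cells are finite
    Boolean combinations of measurable conditions. The empty sets from \<open>k\<close> on keep the
    number of keys finite.\<close>
  define key where "key x = (\<sigma> x, \<lambda>i. if i < k then {c\<in>F. dist c (\<tau> i x) < \<delta>/2} else {})" for x
  define keys where "keys = {1, -1 :: real} \<times> {P. \<forall>i. (i \<in> {..<k} \<longrightarrow> P i \<in> Pow F) \<and> (i \<notin> {..<k} \<longrightarrow> P i = {})}"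
  have fin: "finite keys"
    unfolding keys_def by (intro finite_cartesian_product finite_set_of_finite_funs) (use F(1) in auto)
  have keyin: "key x \<in> keys" if "x \<in> Q" for x
    using fr that by (auto simp: key_def keys_def framed_def)
  define fib where "fib \<kappa> = {x\<in>Q. key x = \<kappa>}" for \<kappa>
  let ?N = "restrict_space (Hk k) Q"
  have Qs: "Q \<in> sets (Hk k)" by (rule framed_sets[OF fr])
  have meas: "hmeasurable k (fib \<kappa>)" if \<kappa>: "\<kappa> \<in> keys" for \<kappa>
  proof -
    obtain s P where sP: "\<kappa> = (s, P)" by (cases \<kappa>)
    have "fib \<kappa> = {x\<in>space ?N. \<sigma> x = s \<and> (\<forall>i\<in>{..<k}. \<forall>c\<in>F. (dist c (\<tau> i x) < \<delta>/2) = (c \<in> P i))}"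
      using \<kappa> by (fastforce simp: fib_def key_def sP keys_def space_restrict_space fun_eq_iff)
    also have "\<dots> \<in> sets ?N"
    proof -
      have [measurable]: "\<sigma> \<in> borel_measurable ?N" using fr by (simp add: framed_def)
      have t: "\<tau> i \<in> borel_measurable ?N" if "i \<in> {..<k}" for i using fr that by (simp add: framed_def)
      have "{x\<in>space ?N. dist c (\<tau> i x) < \<delta>/2} \<in> sets ?N" if "i \<in> {..<k}" for i c
        using t[OF that] by measurable
      then have "{x\<in>space ?N. (dist c (\<tau> i x) < \<delta>/2) = (c \<in> P i)} \<in> sets ?N" if "i \<in> {..<k}" for i c
        using that by (cases "c \<in> P i") (auto intro: sets.sets_Collect_neg)
      then have "{x\<in>space ?N. \<forall>i\<in>{..<k}. \<forall>c\<in>F. (dist c (\<tau> i x) < \<delta>/2) = (c \<in> P i)} \<in> sets ?N"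
        using F(1) by (intro sets.sets_Collect_finite_All) auto
      moreover have "{x\<in>space ?N. \<sigma> x = s} \<in> sets ?N" by measurable
      ultimately show ?thesis by (intro sets.sets_Collect_conj)
    qed
    finally show ?thesis
      using Qs by (simp add: sets_restrict_space_iff sets_Hk)
  qed
  show ?thesis
  proof (rule that[of "fib ` keys"])
    show "finite (fib ` keys)" using fin by simp
    show "\<Union> (fib ` keys) = Q" using keyin by (auto simp: fib_def)
    show "disjoint (fib ` keys)" by (auto simp: disjoint_def fib_def)
    show "hmeasurable k R" if "R \<in> fib ` keys" for R using meas that by auto
    fix R x y i assume R: "R \<in> fib ` keys" "x \<in> R" "y \<in> R"
    then have eq: "key x = key y" "x \<in> Q" "y \<in> Q" by (auto simp: fib_def)
    have "norm (\<tau> i x - \<tau> i y) \<le> \<delta>" if i: "i < k"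
    proof -
      have "\<tau> i x \<in> sphere 0 1"
        using fr eq(2) i norm_orthoframe by (fastforce simp: framed_def)
      then obtain c where c: "c \<in> F" "dist c (\<tau> i x) < \<delta>/2" using F(2) by auto
      have "{c\<in>F. dist c (\<tau> i x) < \<delta>/2} = {c\<in>F. dist c (\<tau> i y) < \<delta>/2}"
        using eq(1) i by (auto simp: key_def dest!: fun_cong[where x=i])
      then have "dist c (\<tau> i y) < \<delta>/2" using c by auto
      then show ?thesis
        using c(2) dist_triangle3[of "\<tau> i x" "\<tau> i y" c] by (simp add: dist_norm)
    qed
    then show "\<sigma> x = \<sigma> y \<and> (i < k \<longrightarrow> norm (\<tau> i x - \<tau> i y) \<le> \<delta>)"
      using eq(1) by (simp add: key_def)
  qed
qed

text \<open>A discrete form of Lusin's theorem: the frame is not made continuous, only nearly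
  constant on finitely many disjoint compact sets, by inner regularity in each cell.\<close>

lemma framed_compact_pieces:
  fixes \<tau> :: "nat \<Rightarrow> 'a::euclidean_space \<Rightarrow> 'a"
  assumes fr: "framed k E Q \<sigma> \<tau>" and \<delta>: "0 < \<delta>" and e: "0 < e"
  obtains \<K> where "finite \<K>" "disjoint \<K>" "\<And>C. C \<in> \<K> \<Longrightarrow> compact C \<and> C \<noteq> {} \<and> C \<subseteq> Q"
    "\<And>C x y i. C \<in> \<K> \<Longrightarrow> x \<in> C \<Longrightarrow> y \<in> C \<Longrightarrow> \<sigma> x = \<sigma> y \<and> (i < k \<longrightarrow> norm (\<tau> i x - \<tau> i y) \<le> \<delta>)"
    "measure (Hk k) (Q - \<Union>\<K>) < e"
proof -
  obtain \<P> where P: "finite \<P>" "\<Union>\<P> = Q" "disjoint \<P>" "\<And>R. R \<in> \<P> \<Longrightarrow> hmeasurable k R"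
    "\<And>R x y i. R \<in> \<P> \<Longrightarrow> x \<in> R \<Longrightarrow> y \<in> R \<Longrightarrow> \<sigma> x = \<sigma> y \<and> (i < k \<longrightarrow> norm (\<tau> i x - \<tau> i y) \<le> \<delta>)"
    using framed_finite_partition[OF fr \<delta>] by blast
  \<comment> \<open>The \<open>+ 1\<close> keeps the denominator positive without cells and makes
    the total loss strictly less than \<open>e\<close>.\<close>
  define e' where "e' = e / (real (card \<P>) + 1)"
  have e': "0 < e'" using e by (simp add: e'_def)
  have fin: "hausdorff_outer k R < \<infinity>" if "R \<in> \<P>" for R
    using fr that P(2) hausdorff_outer_mono[of R Q k] by (auto simp: framed_def intro: le_less_trans)
  have "\<exists>C. compact C \<and> C \<subseteq> R \<and> measure (Hk k) R - e' < measure (Hk k) C" if "R \<in> \<P>" for R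
    using inner_regular_Hk[OF P(4)[OF that] fin[OF that] e'] by metis
  then obtain C where C: "\<And>R. R \<in> \<P> \<Longrightarrow> compact (C R) \<and> C R \<subseteq> R \<and> measure (Hk k) R - e' < measure (Hk k) (C R)"
    by metis
  have Rs: "R \<in> sets (Hk k)" if "R \<in> \<P>" for R using P(4)[OF that] by (simp add: sets_Hk)
  have Cs: "C R \<in> sets (Hk k)" if "R \<in> \<P>" for R
    using C[OF that] borel_subset_Hk[of k] borel_compact[of "C R"] by blast
  have finR: "emeasure (Hk k) R \<noteq> \<infinity>" if "R \<in> \<P>" for R
    using fin[OF that] P(4)[OF that] by (simp add: emeasure_Hk)
  have diff: "measure (Hk k) (R - C R) \<le> e'" if "R \<in> \<P>" for R
    using C[OF that] measure_Diff[OF finR[OF that] Rs[OF that] Cs[OF that]] by auto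
  have "measure (Hk k) (Q - \<Union>(C ` \<P>)) \<le> measure (Hk k) (\<Union>R\<in>\<P>. R - C R)"
  proof (rule measure_mono_fmeasurable)
    show "Q - \<Union>(C ` \<P>) \<subseteq> (\<Union>R\<in>\<P>. R - C R)" using P(2) by auto
    show "Q - \<Union>(C ` \<P>) \<in> sets (Hk k)"
      using framed_sets[OF fr] Cs P(1) by (intro sets.Diff sets.finite_Union) auto
    show "(\<Union>R\<in>\<P>. R - C R) \<in> fmeasurable (Hk k)"
    proof (rule fmeasurableI2)
      show "Q \<in> fmeasurable (Hk k)"
        using framed_sets[OF fr] framed_emeasure[OF fr] by (simp add: fmeasurable_def)
      show "(\<Union>R\<in>\<P>. R - C R) \<subseteq> Q" using P(2) by auto
      show "(\<Union>R\<in>\<P>. R - C R) \<in> sets (Hk k)"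
        using Rs Cs P(1) by (intro sets.finite_UN) auto
    qed
  qed
  also have "\<dots> \<le> (\<Sum>R\<in>\<P>. measure (Hk k) (R - C R))"
  proof (rule measure_subadditive_finite)
    show "emeasure (Hk k) (R - C R) \<noteq> \<infinity>" if "R \<in> \<P>" for R
      using finR[OF that] emeasure_mono[of "R - C R" R "Hk k"] Rs[OF that] by (auto simp: top_unique)
  qed (use P(1) Rs Cs in auto)
  also have "\<dots> \<le> (\<Sum>R\<in>\<P>. e')" by (intro sum_mono diff)
  also have "\<dots> < e"
    using e by (simp add: e'_def divide_simps)
  finally have m: "measure (Hk k) (Q - \<Union>(C ` \<P>)) < e" .
  show ?thesis
  \<comment> \<open>Empty pieces are dropped because a base point will be chosen in each
    piece.\<close>
  proof (rule that[of "C ` \<P> - {{}}"])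
    show "disjoint (C ` \<P> - {{}})"
    proof (rule disjointI)
      fix A B assume "A \<in> C ` \<P> - {{}}" "B \<in> C ` \<P> - {{}}" "A \<noteq> B"
      then obtain R R' where "R \<in> \<P>" "R' \<in> \<P>" "A = C R" "B = C R'" "R \<noteq> R'" by auto
      then show "A \<inter> B = {}" using C P(3) unfolding disjoint_def by blast
    qed
    show "compact D \<and> D \<noteq> {} \<and> D \<subseteq> Q" if "D \<in> C ` \<P> - {{}}" for D
      using that C P(2) by auto
    show "\<sigma> x = \<sigma> y \<and> (i < k \<longrightarrow> norm (\<tau> i x - \<tau> i y) \<le> \<delta>)"
      if "D \<in> C ` \<P> - {{}}" "x \<in> D" "y \<in> D" for D x y i
      using that C P(5) by blast
    have "\<Union>(C ` \<P> - {{}}) = \<Union>(C ` \<P>)" by auto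
    then show "measure (Hk k) (Q - \<Union>(C ` \<P> - {{}})) < e" using m by simp
  qed (use P(1) in auto)
qed

lemma kcovector_sum:
  assumes "finite P" "\<And>p. p \<in> P \<Longrightarrow> kcovector k (f p)"
  shows "kcovector k (\<lambda>vs. \<Sum>p\<in>P. c p * f p vs)"
proof -
  have "linear (\<lambda>v. \<Sum>p\<in>P. c p * f p (vs[i := v]))" if "length vs = k \<and> i < k" for vs i
  proof (rule linear_compose_sum, rule ballI)
    fix p assume "p \<in> P"
    then have "linear (\<lambda>v. f p (vs[i := v]))"
      using assms(2) that unfolding kcovector_def by blast
    then show "linear (\<lambda>v. c p * f p (vs[i := v]))"
      by (simp add: linear_iff algebra_simps)
  qed
  then show ?thesis
    using assms(2) unfolding kcovector_def by (auto intro!: sum.neutral)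
qed

text \<open>Each condition compares a compact set with a disjoint closed one and so holds for all
  small \<rho>; finitely many hold together. The factor 2 makes room for disjoint
  \<rho>-neighbourhoods.\<close>

lemma exists_uniform_gap:
  assumes fin: "finite P" and cpt: "\<And>p. p \<in> P \<Longrightarrow> compact (C p)" and op: "open A"
    and sub: "\<And>p. p \<in> P \<Longrightarrow> C p \<subseteq> A"
    and disj: "\<And>p q. p \<in> P \<Longrightarrow> q \<in> P \<Longrightarrow> p \<noteq> q \<Longrightarrow> C p \<inter> C q = {}"
  shows "\<exists>\<rho>>0. (\<forall>p\<in>P. \<forall>q\<in>P. p \<noteq> q \<longrightarrow> (\<forall>x\<in>C p. \<forall>y\<in>C q. 2 * \<rho> \<le> dist x y)) \<and>
    (\<forall>p\<in>P. \<forall>x\<in>C p. \<forall>y\<in>-A. 2 * \<rho> \<le> dist x (y::'a::euclidean_space))"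
proof -
  have ev: "\<forall>\<^sub>F \<rho> in at_right 0. \<forall>x\<in>X. \<forall>y\<in>Y. 2 * \<rho> \<le> dist x y"
    if XY: "compact X" "closed Y" "X \<inter> Y = {}" for X Y :: "'a set"
  proof -
    obtain d where d: "0 < d" "\<forall>x\<in>X. \<forall>y\<in>Y. d \<le> dist x y"
      using separate_compact_closed[OF XY] by auto
    have "\<forall>\<^sub>F \<rho> in at_right 0. \<rho> < d / 2"
      using d by (intro order_tendstoD(2)[OF tendsto_ident_at]) auto
    then show ?thesis by eventually_elim (use d in fastforce)
  qed
  have 1: "\<forall>\<^sub>F \<rho> in at_right 0. \<forall>p\<in>P. \<forall>q\<in>P. p \<noteq> q \<longrightarrow> (\<forall>x\<in>C p. \<forall>y\<in>C q. 2 * \<rho> \<le> dist x y)"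
    using ev cpt disj fin by (intro eventually_ball_finite ballI) (auto simp: compact_imp_closed)
  have 2: "\<forall>\<^sub>F \<rho> in at_right 0. \<forall>p\<in>P. \<forall>x\<in>C p. \<forall>y\<in>-A. 2 * \<rho> \<le> dist x y"
    using cpt op sub fin by (intro eventually_ball_finite ballI ev) auto
  have "\<forall>\<^sub>F \<rho> :: real in at_right 0. 0 < \<rho>"
    by (rule eventually_at_right_less)
  from eventually_happens'[OF trivial_limit_at_right_real eventually_conj[OF this eventually_conj[OF 1 2]]]
  show ?thesis by auto
qed

text \<open>Each \<open>Q i\<close> is cut into finitely many pieces on which the frame hardly varies; compact
  subsets of these pieces are at positive distance from each other, so constant determinant
  forms on them can be glued by bump functions with disjoint supports without raising the comass.\<close>
lemma exists_almost_dual_form: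
  fixes \<tau> :: "'i \<Rightarrow> nat \<Rightarrow> 'a::euclidean_space \<Rightarrow> 'a"
  assumes E: "compact E" and A: "open A" and I: "finite I"
    and fr: "\<And>i. i \<in> I \<Longrightarrow> framed k E (Q i) (\<sigma> i) (\<tau> i)"
    and QA: "\<And>i. i \<in> I \<Longrightarrow> Q i \<subseteq> A" and disjQ: "disjoint_family_on Q I" and e: "0 < e"
  shows "\<exists>\<omega>\<in>D0 k E. comass_le k E 1 \<omega> \<and> closure {x\<in>E. \<omega> x \<noteq> (\<lambda>_. 0)} \<subseteq> A \<and>
    (\<exists>K. \<forall>i\<in>I. compact (K i) \<and> K i \<subseteq> Q i \<and> measure (Hk k) (Q i - K i) < e
        \<and> (\<forall>x\<in>K i. 1 - e \<le> kpair k \<omega> (\<sigma> i) (\<tau> i) x))"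
proof -
  \<comment> \<open>Chosen so that the error of \<open>det_form_close\<close> is at most
    \<open>e\<close>; the \<open>+ 1\<close> avoids division by zero for
    \<open>k = 0\<close>.\<close>
  define \<delta> where "\<delta> = e / (fact k * (real k + 1))"
  have \<delta>: "0 < \<delta>" using e by (simp add: \<delta>_def)
  have \<delta>e: "fact k * (real k * \<delta>) \<le> e"
    using e by (simp add: \<delta>_def divide_simps)
  have ex: "\<exists>\<K>. finite \<K> \<and> disjoint \<K> \<and> (\<forall>C\<in>\<K>. compact C \<and> C \<noteq> {} \<and> C \<subseteq> Q i) \<and>
      (\<forall>C\<in>\<K>. \<forall>x\<in>C. \<forall>y\<in>C. \<sigma> i x = \<sigma> i y \<and> (\<forall>a<k. norm (\<tau> i a x - \<tau> i a y) \<le> \<delta>)) \<and>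
      measure (Hk k) (Q i - \<Union>\<K>) < e" if i: "i \<in> I" for i
  proof (rule framed_compact_pieces[OF fr[OF i] \<delta> e])
    fix \<K> :: "'a set set"
    assume *: "finite \<K>" "disjoint \<K>" "measure (Hk k) (Q i - \<Union>\<K>) < e"
      and 1: "\<And>C. C \<in> \<K> \<Longrightarrow> compact C \<and> C \<noteq> {} \<and> C \<subseteq> Q i"
      and 2: "\<And>C x y a. C \<in> \<K> \<Longrightarrow> x \<in> C \<Longrightarrow> y \<in> C \<Longrightarrow>
        \<sigma> i x = \<sigma> i y \<and> (a < k \<longrightarrow> norm (\<tau> i a x - \<tau> i a y) \<le> \<delta>)"
    have "\<forall>C\<in>\<K>. \<forall>x\<in>C. \<forall>y\<in>C. \<sigma> i x = \<sigma> i y \<and> (\<forall>a<k. norm (\<tau> i a x - \<tau> i a y) \<le> \<delta>)"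
      by (intro ballI conjI allI impI 2[THEN conjunct1] 2[THEN conjunct2, THEN mp])
    moreover have "\<forall>C\<in>\<K>. compact C \<and> C \<noteq> {} \<and> C \<subseteq> Q i"
      by (rule ballI) (rule 1)
    ultimately show ?thesis
      using * by (intro exI[of _ \<K>] conjI)
  qed
  obtain \<K> where "\<forall>i\<in>I. finite (\<K> i) \<and> disjoint (\<K> i) \<and>
      (\<forall>C\<in>\<K> i. compact C \<and> C \<noteq> {} \<and> C \<subseteq> Q i) \<and>
      (\<forall>C\<in>\<K> i. \<forall>x\<in>C. \<forall>y\<in>C. \<sigma> i x = \<sigma> i y \<and> (\<forall>a<k. norm (\<tau> i a x - \<tau> i a y) \<le> \<delta>)) \<and>
      measure (Hk k) (Q i - \<Union>(\<K> i)) < e"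
    using bchoice[OF ballI[OF ex]] by (rule exE)
  note \<K> = bspec[OF this]
  \<comment> \<open>Pieces carry the index of their \<open>Q i\<close>, which tells whose frame and
    sign to freeze at the base point.\<close>
  define P where "P = Sigma I \<K>"
  have finP: "finite P" unfolding P_def using I \<K> by auto
  have Pc: "compact (snd p)" "snd p \<noteq> {}" "snd p \<subseteq> Q (fst p)" "fst p \<in> I" if "p \<in> P" for p
  proof -
    have "snd p \<in> \<K> (fst p)" "fst p \<in> I" using that by (auto simp: P_def)
    then show "compact (snd p)" "snd p \<noteq> {}" "snd p \<subseteq> Q (fst p)" "fst p \<in> I"
      using \<K>[of "fst p"] by blast+
  qed
  have Pdisj: "snd p \<inter> snd q = {}" if "p \<in> P" "q \<in> P" "p \<noteq> q" for p q
  proof (cases "fst p = fst q")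
    case True
    then have "snd p \<noteq> snd q" using that(3) by (simp add: prod_eq_iff)
    moreover have "snd p \<in> \<K> (fst p)" "snd q \<in> \<K> (fst p)" "fst p \<in> I"
      using that True by (auto simp: P_def)
    ultimately show ?thesis
      using \<K>[of "fst p"] by (meson disjointD)
  next
    case False
    then have "Q (fst p) \<inter> Q (fst q) = {}"
      using disjQ Pc that by (simp add: disjoint_family_on_def)
    then show ?thesis using Pc(3) that by blast
  qed
  have Psub: "snd p \<subseteq> A" if "p \<in> P" for p
    using Pc(3,4)[OF that] QA by blast
  obtain \<rho> :: real where "0 < \<rho>"
      and gap: "\<forall>p\<in>P. \<forall>q\<in>P. p \<noteq> q \<longrightarrow> (\<forall>x\<in>snd p. \<forall>y\<in>snd q. 2 * \<rho> \<le> dist x y)"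
        "\<forall>p\<in>P. \<forall>x\<in>snd p. \<forall>y\<in>-A. 2 * \<rho> \<le> dist x y"
  proof -
    have "\<exists>\<rho>>0. (\<forall>p\<in>P. \<forall>q\<in>P. p \<noteq> q \<longrightarrow> (\<forall>x\<in>snd p. \<forall>y\<in>snd q. 2 * \<rho> \<le> dist x y)) \<and>
        (\<forall>p\<in>P. \<forall>x\<in>snd p. \<forall>y\<in>-A. 2 * \<rho> \<le> dist x y)"
      by (rule exists_uniform_gap[OF finP _ A]) (simp_all add: Pc(1) Psub Pdisj)
    then show ?thesis using that by blast
  qed
  have \<rho>: "0 < \<rho>"
    "\<And>p q x y. p \<in> P \<Longrightarrow> q \<in> P \<Longrightarrow> p \<noteq> q \<Longrightarrow> x \<in> snd p \<Longrightarrow> y \<in> snd q \<Longrightarrow> 2 * \<rho> \<le> dist x y"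
    "\<And>p x y. p \<in> P \<Longrightarrow> x \<in> snd p \<Longrightarrow> y \<notin> A \<Longrightarrow> 2 * \<rho> \<le> dist x y"
    using \<open>0 < \<rho>\<close> gap by auto
  define x0 where "x0 p = (SOME x. x \<in> snd p)" for p :: "'i \<times> 'a set"
  have x0: "x0 p \<in> snd p" if "p \<in> P" for p
    using Pc(2)[OF that] unfolding x0_def by (simp add: some_in_eq)
  \<comment> \<open>A tent: 1 on the piece and 0 from distance \<rho> on.\<close>
  define \<psi> where "\<psi> p x = max 0 (1 - infdist x (snd p) / \<rho>)" for p :: "'i \<times> 'a set" and x
  define s where "s p = \<sigma> (fst p) (x0 p)" for p
  define t where "t p a = \<tau> (fst p) a (x0 p)" for p a
  have s1: "\<bar>s p\<bar> = 1" and tp: "orthoframe k (t p)" if "p \<in> P" for p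
  proof -
    have "x0 p \<in> Q (fst p)" using x0[OF that] Pc(3)[OF that] by blast
    then have "\<sigma> (fst p) (x0 p) = 1 \<or> \<sigma> (fst p) (x0 p) = -1" "orthoframe k (\<lambda>a. \<tau> (fst p) a (x0 p))"
      using fr[OF Pc(4)[OF that]] by (auto simp: framed_def)
    then show "\<bar>s p\<bar> = 1" "orthoframe k (t p)"
      unfolding s_def t_def by auto
  qed
  have near: "\<exists>c\<in>snd p. dist x c = infdist x (snd p)" if "p \<in> P" for p x
    using infdist_attains_inf[OF compact_imp_closed[OF Pc(1)[OF that]] Pc(2)[OF that], of x] by metis
  have \<psi>_bound: "0 \<le> \<psi> p x" "\<psi> p x \<le> 1" for p x
    using \<rho>(1) infdist_nonneg[of x "snd p"] by (auto simp: \<psi>_def)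
  have \<psi>_near: "infdist x (snd p) < \<rho>" if "\<psi> p x \<noteq> 0" for p x
    using that \<rho>(1) by (auto simp: \<psi>_def max_def divide_simps split: if_splits)
  \<comment> \<open>Two tents alive at \<open>x\<close> would have pieces less than
    \<open>2 * \<rho>\<close> apart.\<close>
  have \<psi>_unique: "p = q" if pq_in: "p \<in> P" "q \<in> P" "\<psi> p x \<noteq> 0" "\<psi> q x \<noteq> 0" for p q x
  proof (rule ccontr)
    assume pq: "p \<noteq> q"
    obtain c d where cd: "c \<in> snd p" "dist x c = infdist x (snd p)" "d \<in> snd q" "dist x d = infdist x (snd q)"
      using near[OF pq_in(1), of x] near[OF pq_in(2), of x] by blast
    have "2 * \<rho> \<le> dist c d" using \<rho>(2)[OF pq_in(1,2) pq cd(1,3)] .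
    also have "\<dots> \<le> dist x c + dist x d" by (rule dist_triangle3)
    finally show False
      using \<psi>_near[OF pq_in(3)] \<psi>_near[OF pq_in(4)] cd by simp
  qed
  define \<omega> where "\<omega> x = (if x \<in> E then (\<lambda>vs. \<Sum>p\<in>P. (\<psi> p x * s p) * det_form k (t p) vs) else (\<lambda>_. 0))" for x
  have single: "\<omega> x = (\<lambda>vs. (\<psi> p x * s p) * det_form k (t p) vs)" if xp: "x \<in> E" "p \<in> P" "\<psi> p x \<noteq> 0" for x p
  proof
    fix vs
    have zero: "\<psi> q x = 0" if "q \<in> P - {p}" for q
      using \<psi>_unique[of q p x] that xp(2,3) by blast
    have "(\<Sum>q\<in>P. (\<psi> q x * s q) * det_form k (t q) vs) = (\<Sum>q\<in>{p}. (\<psi> q x * s q) * det_form k (t q) vs)"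
      using finP xp(2) by (rule_tac sum.mono_neutral_right) (simp_all add: zero)
    then show "\<omega> x vs = (\<psi> p x * s p) * det_form k (t p) vs"
      using xp(1) by (simp add: \<omega>_def)
  qed
  have \<omega>0: "\<omega> x = (\<lambda>_. 0)" if "\<And>p. p \<in> P \<Longrightarrow> \<psi> p x = 0" for x
    using that by (auto simp: \<omega>_def)
  have D0: "\<omega> \<in> D0 k E"
    unfolding D0_def
  proof (intro CollectI conjI ballI allI impI)
    fix x assume "x \<in> E"
    then show "kcovector k (\<omega> x)"
      by (simp add: \<omega>_def kcovector_sum[OF finP kcovector_det_form])
  next
    fix vs
    have "continuous_on E (\<lambda>x. \<Sum>p\<in>P. (\<psi> p x * s p) * det_form k (t p) vs)"
      unfolding \<psi>_def using \<rho>(1) by (intro continuous_intros) auto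
    then show "continuous_on E (\<lambda>x. \<omega> x vs)"
      by (rule continuous_on_cong[THEN iffD1, rotated 2]) (auto simp: \<omega>_def)
  qed (simp add: \<omega>_def)
  have cm: "comass_le k E 1 \<omega>"
    unfolding comass_le_def
  proof (intro ballI allI impI)
    fix x and u :: "nat \<Rightarrow> 'a" assume x: "x \<in> E" and u: "orthoframe k u"
    show "\<bar>\<omega> x (map u [0..<k])\<bar> \<le> 1"
    proof (cases "\<exists>p\<in>P. \<psi> p x \<noteq> 0")
      case True
      then obtain p where p: "p \<in> P" "\<psi> p x \<noteq> 0" by blast
      have "\<bar>\<psi> p x\<bar> * \<bar>det_form k (t p) (map u [0..<k])\<bar> \<le> 1"
        using \<psi>_bound[of p x] det_form_comass[OF tp[OF p(1)] u] by (intro mult_le_one) auto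
      then show ?thesis
        using single[OF x p] s1[OF p(1)] by (simp add: abs_mult)
    next
      case False
      then show ?thesis using \<omega>0[of x] by auto
    qed
  qed
  \<comment> \<open>The closure can reach distance exactly \<rho> from a piece, still short of the
    \<open>2 * \<rho>\<close> that separates the pieces from the complement of
    \<open>A\<close>.\<close>
  have "closure {x\<in>E. \<omega> x \<noteq> (\<lambda>_. 0)} \<subseteq> (\<Union>p\<in>P. {x. infdist x (snd p) \<le> \<rho>})"
  proof (rule closure_minimal)
    show "{x\<in>E. \<omega> x \<noteq> (\<lambda>_. 0)} \<subseteq> (\<Union>p\<in>P. {x. infdist x (snd p) \<le> \<rho>})"
      using \<omega>0 \<psi>_near less_imp_le by blast
    show "closed (\<Union>p\<in>P. {x. infdist x (snd p) \<le> \<rho>})"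
      using finP by (intro closed_UN ballI closed_Collect_le continuous_intros) auto
  qed
  also have "\<dots> \<subseteq> A"
  proof
    fix x assume "x \<in> (\<Union>p\<in>P. {x. infdist x (snd p) \<le> \<rho>})"
    then obtain p where p: "p \<in> P" "infdist x (snd p) \<le> \<rho>" by auto
    obtain c where "c \<in> snd p" "dist x c = infdist x (snd p)" using near[OF p(1)] by blast
    then show "x \<in> A" using \<rho>(1) \<rho>(3)[OF p(1), of c x] p(2) by (force simp: dist_commute)
  qed
  finally have supp: "closure {x\<in>E. \<omega> x \<noteq> (\<lambda>_. 0)} \<subseteq> A" .
  show ?thesis
  proof (intro bexI[OF _ D0] conjI cm supp exI[of _ "\<lambda>i. \<Union>(\<K> i)"] ballI)
    fix i assume i: "i \<in> I"
    show "compact (\<Union>(\<K> i))" using \<K>[OF i] by (intro compact_Union) auto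
    show "\<Union>(\<K> i) \<subseteq> Q i" using \<K>[OF i] by auto
    show "measure (Hk k) (Q i - \<Union>(\<K> i)) < e" using \<K>[OF i] by auto
    fix x assume "x \<in> \<Union>(\<K> i)"
    then obtain C where C: "C \<in> \<K> i" "x \<in> C" by auto
    define p where "p = (i, C)"
    have p: "p \<in> P" "fst p = i" "snd p = C" using C i by (auto simp: P_def p_def)
    have x: "x \<in> Q i" using \<K>[OF i] C by auto
    then have xE: "x \<in> E" using fr[OF i] by (auto simp: framed_def)
    have \<psi>1: "\<psi> p x = 1" using C by (simp add: \<psi>_def p)
    have x0C: "x0 p \<in> C" using x0[OF p(1)] p by simp
    have sx: "\<sigma> i x * s p = 1"
      using \<K>[OF i] C x0C s1[OF p(1)] unfolding s_def p(2)
      by (metis abs_mult_self_eq mult.right_neutral)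
    have fx: "orthoframe k (\<lambda>a. \<tau> i a x)"
      using fr[OF i] x by (auto simp: framed_def)
    have "1 - e \<le> 1 - fact k * (real k * \<delta>)" using \<delta>e by simp
    also have "\<dots> \<le> det_form k (t p) (map (\<lambda>a. \<tau> i a x) [0..<k])"
    proof (rule det_form_close[OF tp[OF p(1)] fx])
      show "norm (\<tau> i a x - t p a) \<le> \<delta>" if "a < k" for a
        using \<K>[OF i] C x0C that unfolding t_def p(2) by blast
    qed
    also have "\<dots> = kpair k \<omega> (\<sigma> i) (\<tau> i) x"
      using single[OF xE p(1)] \<psi>1 sx by (simp add: kpair_def)
    finally show "1 - e \<le> kpair k \<omega> (\<sigma> i) (\<tau> i) x" .
  qed
qed

subsection \<open>Averaging currents and their supports\<close>

text \<open>The carrier splits into a good part \<open>K\<close>, an exceptional part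
  \<open>Z\<close> on which comass 1 still gives at least -1, and a rest where the form contributes
  nothing.\<close>

lemma kpair_integral_lower_bound:
  assumes fr: "framed k E S \<sigma> \<tau>" and \<omega>: "\<omega> \<in> D0 k E" and E: "compact E" and c: "comass_le k E 1 \<omega>"
    and K: "K \<in> sets (Hk k)" "K \<subseteq> S" "\<And>x. x \<in> K \<Longrightarrow> 1 - e \<le> kpair k \<omega> \<sigma> \<tau> x"
    and Z: "Z \<in> sets (Hk k)" "Z \<subseteq> S" "K \<inter> Z = {}" "\<And>x. x \<in> S - K - Z \<Longrightarrow> kpair k \<omega> \<sigma> \<tau> x = 0"
  shows "(1 - e) * measure (Hk k) K - measure (Hk k) Z \<le> (LINT x:S|Hk k. kpair k \<omega> \<sigma> \<tau> x)"
proof -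
  have S: "S \<in> sets (Hk k)" by (rule framed_sets[OF fr])
  have fin: "emeasure (Hk k) X < \<infinity>" if "X \<subseteq> S" for X
    using emeasure_mono[OF that S] framed_emeasure[OF fr] by (rule le_less_trans)
  have int: "integrable (Hk k) (indicator K :: 'a \<Rightarrow> real)" "integrable (Hk k) (indicator Z :: 'a \<Rightarrow> real)"
    using K(1,2) Z(1,2) fin by simp_all
  have "(1 - e) * measure (Hk k) K - measure (Hk k) Z
      = (\<integral>x. (1 - e) * indicator K x - indicator Z x \<partial>Hk k)"
    using int by simp
  also have "\<dots> \<le> (LINT x:S|Hk k. kpair k \<omega> \<sigma> \<tau> x)"
    unfolding set_lebesgue_integral_def
  proof (rule integral_mono)
    show "integrable (Hk k) (\<lambda>x. (1 - e) * indicator K x - indicator Z x :: real)"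
      using int by simp
    show "integrable (Hk k) (\<lambda>x. indicator S x *\<^sub>R kpair k \<omega> \<sigma> \<tau> x)"
      using kpair_integrable[OF fr \<omega> E] by (simp add: set_integrable_def)
    fix x
    consider "x \<in> K" | "x \<in> Z" | "x \<in> S - K - Z" | "x \<notin> S" by blast
    then show "(1 - e) * indicator K x - indicator Z x \<le> indicator S x *\<^sub>R kpair k \<omega> \<sigma> \<tau> x"
    proof cases
      case 1
      then have "x \<notin> Z" "x \<in> S" using Z K by auto
      with 1 show ?thesis using K(3) by simp
    next
      case 2
      then have "x \<notin> K" "x \<in> S" using Z K by auto
      with 2 show ?thesis using kpair_comass[OF fr c, of x] by simp
    next
      case 3
      then show ?thesis using Z(4) by simp
    next
      case 4
      then have "x \<notin> K" "x \<notin> Z" using Z K by auto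
      with 4 show ?thesis by simp
    qed
  qed
  finally show ?thesis .
qed

lemma hmeasurable_iff_sets: "hmeasurable k A \<longleftrightarrow> A \<in> sets (Hk k)"
  by (simp add: sets_Hk)

lemma compact_sets_Hk: "compact K \<Longrightarrow> K \<in> sets (Hk k)"
  using borel_subset_Hk[of k] borel_compact[of K] by blast

text \<open>If \<open>S \<inter> A\<close> had positive measure, an almost dual form supported in
  \<open>A\<close> would give the current a positive value.\<close>

lemma null_of_vanishing:
  assumes fr: "framed k E S \<sigma> \<tau>" and E: "compact E" and A: "open A" and pos: "0 < measure (Hk k) S"
    and van: "\<And>\<omega>. \<omega> \<in> D0 k E \<Longrightarrow> closure {x\<in>E. \<omega> x \<noteq> (\<lambda>_. 0)} \<subseteq> A \<Longrightarrow> avg_current k S \<sigma> \<tau> \<omega> = 0"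
  shows "S \<inter> A \<in> null_sets (Hk k)"
proof (rule ccontr)
  let ?m = "measure (Hk k)"
  have S: "S \<in> sets (Hk k)" by (rule framed_sets[OF fr])
  have As: "A \<in> sets (Hk k)" using borel_subset_Hk[of k] A by auto
  have fin: "emeasure (Hk k) X < \<infinity>" if "X \<subseteq> S" for X
    using emeasure_mono[OF that S] framed_emeasure[OF fr] by (rule le_less_trans)
  assume "\<not> ?thesis"
  then have "emeasure (Hk k) (S \<inter> A) \<noteq> 0" using S As by auto
  then have m: "0 < ?m (S \<inter> A)"
    using fin[of "S \<inter> A"] by (simp add: measure_def enn2real_positive_iff zero_less_iff_neq_zero)
  \<comment> \<open>With \<open>m\<close> the measure of \<open>S \<inter> A\<close>, the good part
    contributes at least \<open>1/2 * 3/4 * m\<close>, while the exceptional part costs less than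
    \<open>m / 4\<close>.\<close>
  define e where "e = min (1/2) (?m (S \<inter> A) / 4)"
  have e: "0 < e" "e \<le> 1/2" "e \<le> ?m (S \<inter> A) / 4" using m by (auto simp: e_def)
  have frA: "framed k E (S \<inter> A) \<sigma> \<tau>"
    by (rule framed_subset[OF fr]) (use S As in \<open>auto simp: hmeasurable_iff_sets\<close>)
  have disj: "disjoint_family_on (\<lambda>_. S \<inter> A) {()}" by (simp add: disjoint_family_on_def)
  have "\<exists>\<omega>\<in>D0 k E. comass_le k E 1 \<omega> \<and> closure {x\<in>E. \<omega> x \<noteq> (\<lambda>_. 0)} \<subseteq> A \<and>
    (\<exists>K. \<forall>i\<in>{()}. compact (K i) \<and> K i \<subseteq> S \<inter> A \<and> ?m (S \<inter> A - K i) < e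
        \<and> (\<forall>x\<in>K i. 1 - e \<le> kpair k \<omega> \<sigma> \<tau> x))"
    by (rule exists_almost_dual_form[OF E A _ frA Int_lower2 disj e(1)]) simp
  then obtain \<omega> K where \<omega>: "\<omega> \<in> D0 k E" "comass_le k E 1 \<omega>" "closure {x\<in>E. \<omega> x \<noteq> (\<lambda>_. 0)} \<subseteq> A"
    and K: "compact (K ())" "K () \<subseteq> S \<inter> A" "?m (S \<inter> A - K ()) < e"
      "\<forall>x\<in>K (). 1 - e \<le> kpair k \<omega> \<sigma> \<tau> x"
    by auto
  define C where "C = K ()"
  have C: "compact C" "C \<subseteq> S \<inter> A" "?m (S \<inter> A - C) < e" "\<And>x. x \<in> C \<Longrightarrow> 1 - e \<le> kpair k \<omega> \<sigma> \<tau> x"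
    using K by (auto simp: C_def)
  have Cs: "C \<in> sets (Hk k)" using C(1) by (rule compact_sets_Hk)
  have "(1 - e) * ?m C - ?m (S \<inter> A - C) \<le> (LINT x:S|Hk k. kpair k \<omega> \<sigma> \<tau> x)"
  proof (rule kpair_integral_lower_bound[OF fr \<omega>(1) E \<omega>(2) Cs _ C(4)])
    fix x assume x: "x \<in> S - C - (S \<inter> A - C)"
    then have "x \<in> E" "x \<notin> A" using fr by (auto simp: framed_def)
    moreover have "{x\<in>E. \<omega> x \<noteq> (\<lambda>_. 0)} \<subseteq> A"
      using closure_subset \<omega>(3) by (rule order_trans)
    ultimately have "\<omega> x = (\<lambda>_. 0)" by auto
    then show "kpair k \<omega> \<sigma> \<tau> x = 0" by (simp add: kpair_def)
  qed (use C S As Cs in auto)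
  moreover have "?m C = ?m (S \<inter> A) - ?m (S \<inter> A - C)"
    using measure_Diff[of "Hk k" "S \<inter> A" C] fin[of "S \<inter> A"] S As Cs C(2) by simp
  moreover have "(LINT x:S|Hk k. kpair k \<omega> \<sigma> \<tau> x) = 0"
    using van[OF \<omega>(1,3)] pos by (simp add: avg_current_def)
  ultimately have "(1 - e) * (?m (S \<inter> A) - ?m (S \<inter> A - C)) \<le> ?m (S \<inter> A - C)" by simp
  moreover have "1/2 * (?m (S \<inter> A) * (3/4)) \<le> (1 - e) * (?m (S \<inter> A) - ?m (S \<inter> A - C))"
    using e C(3) m by (intro mult_mono) auto
  ultimately show False using C(3) e m by linarith
qed

text \<open>The complement of the support is a union of possibly uncountably many open sets;
  Lindelof's theorem makes countably many suffice, and null sets add up.\<close>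

lemma null_outside_fsupp:
  assumes fr: "framed k E S \<sigma> \<tau>" and E: "compact E" and pos: "0 < measure (Hk k) S"
  shows "hausdorff_outer k (S - fsupp k E (avg_current k S \<sigma> \<tau>)) = 0"
proof -
  define \<A> where "\<A> = {A. open A \<and> (\<forall>\<omega>\<in>D0 k E. closure {x\<in>E. \<omega> x \<noteq> (\<lambda>_. 0)} \<subseteq> A \<longrightarrow> avg_current k S \<sigma> \<tau> \<omega> = 0)}"
  obtain \<A>' where \<A>': "\<A>' \<subseteq> \<A>" "countable \<A>'" "\<Union>\<A>' = \<Union>\<A>"
    using Lindelof[of \<A>] by (auto simp: \<A>_def)
  have "(\<Union>A\<in>\<A>'. S \<inter> A) \<in> null_sets (Hk k)"
  proof (rule null_sets_UN'[OF \<A>'(2)])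
    fix A assume "A \<in> \<A>'"
    then have "open A" "\<And>\<omega>. \<omega> \<in> D0 k E \<Longrightarrow> closure {x\<in>E. \<omega> x \<noteq> (\<lambda>_. 0)} \<subseteq> A \<Longrightarrow> avg_current k S \<sigma> \<tau> \<omega> = 0"
      using \<A>'(1) by (auto simp: \<A>_def)
    then show "S \<inter> A \<in> null_sets (Hk k)" by (rule null_of_vanishing[OF fr E _ pos])
  qed
  moreover have "S - fsupp k E (avg_current k S \<sigma> \<tau>) = (\<Union>A\<in>\<A>'. S \<inter> A)"
    using fr \<A>'(3) by (auto simp: fsupp_def \<A>_def[symmetric] framed_def)
  ultimately show ?thesis
    by (simp add: null_sets_def emeasure_Hk[symmetric] sets_Hk)
qed

section \<open>One form almost dual to several currents with prescribed signs\<close>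

lemma kpair_scale: "kpair k \<omega> (\<lambda>x. s * \<sigma> x) \<tau> x = s * kpair k \<omega> \<sigma> \<tau> x"
  by (simp add: kpair_def)

lemma framed_scale:
  assumes "framed k E S \<sigma> \<tau>" "s = 1 \<or> s = -1"
  shows "framed k E S (\<lambda>x. s * \<sigma> x) \<tau>"
  using assms unfolding framed_def by (auto intro: borel_measurable_times)

text \<open>Since carriers are null outside the supports, null intersections of supports pass to the
  carriers. For \<open>M = 1\<close> the support condition is void, so any single current has an
  almost dual form.\<close>

lemma almost_dual_form_avg_currents:
  fixes T :: "nat \<Rightarrow> 'a::euclidean_space kform \<Rightarrow> real"
  assumes E: "compact E" and T: "\<And>i. i < M \<Longrightarrow> T i \<in> Ak k E"
    and supp: "\<And>i j. i < M \<Longrightarrow> j < M \<Longrightarrow> i \<noteq> j \<Longrightarrow> hausdorff_outer k (fsupp k E (T i) \<inter> fsupp k E (T j)) = 0"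
    and s: "\<And>i. i < M \<Longrightarrow> s i = 1 \<or> s i = (-1::real)" and e: "0 < e"
  obtains \<omega> where "\<omega> \<in> D0 k E" "comass_le k E 1 \<omega>" "\<And>i. i < M \<Longrightarrow> 1 - e \<le> s i * T i \<omega>"
proof -
  let ?m = "measure (Hk k :: 'a measure)"
  have ex: "\<forall>i\<in>{..<M}. \<exists>D. T i = avg_current k (fst D) (fst (snd D)) (snd (snd D))
      \<and> framed k E (fst D) (fst (snd D)) (snd (snd D)) \<and> 0 < ?m (fst D)"
  proof
    fix i assume "i \<in> {..<M}"
    then obtain S \<sigma> \<tau> where "T i = avg_current k S \<sigma> \<tau>" "framed k E S \<sigma> \<tau>" "0 < ?m S"
      using Ak_framed[OF T[of i]] by auto
    then show "\<exists>D. T i = avg_current k (fst D) (fst (snd D)) (snd (snd D))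
      \<and> framed k E (fst D) (fst (snd D)) (snd (snd D)) \<and> 0 < ?m (fst D)"
      by (intro exI[of _ "(S, \<sigma>, \<tau>)"]) simp
  qed
  obtain D where D: "\<forall>i\<in>{..<M}. T i = avg_current k (fst (D i)) (fst (snd (D i))) (snd (snd (D i)))
      \<and> framed k E (fst (D i)) (fst (snd (D i))) (snd (snd (D i))) \<and> 0 < ?m (fst (D i))"
    using bchoice[OF ex] by (rule exE)
  define S where "S i = fst (D i)" for i
  define \<sigma> where "\<sigma> i = fst (snd (D i))" for i
  define \<tau> where "\<tau> i = snd (snd (D i))" for i
  have Ti: "T i = avg_current k (S i) (\<sigma> i) (\<tau> i)" and fr: "framed k E (S i) (\<sigma> i) (\<tau> i)"
    and pos: "0 < ?m (S i)" if "i < M" for i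
    using D that by (auto simp: S_def \<sigma>_def \<tau>_def)
  have Ss: "S i \<in> sets (Hk k)" if "i < M" for i by (rule framed_sets[OF fr[OF that]])
  have fin: "emeasure (Hk k) X < \<infinity>" if "X \<subseteq> S i" "i < M" for X i
    using emeasure_mono[OF that(1) Ss[OF that(2)]] framed_emeasure[OF fr[OF that(2)]] by (rule le_less_trans)
  have overlap: "S i \<inter> S j \<in> null_sets (Hk k)" if ij: "i < M" "j < M" "i \<noteq> j" for i j
  proof -
    have "S i \<inter> S j \<subseteq> (fsupp k E (T i) \<inter> fsupp k E (T j)) \<union> ((S i - fsupp k E (T i)) \<union> (S j - fsupp k E (T j)))"
      by blast
    then have "hausdorff_outer k (S i \<inter> S j) \<le> hausdorff_outer k (fsupp k E (T i) \<inter> fsupp k E (T j))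
        + (hausdorff_outer k (S i - fsupp k E (T i)) + hausdorff_outer k (S j - fsupp k E (T j)))"
      by (meson hausdorff_outer_mono hausdorff_outer_subadditive add_left_mono order_trans)
    also have "\<dots> = 0"
      using null_outside_fsupp[OF fr E pos] Ti supp ij by simp
    finally have "hausdorff_outer k (S i \<inter> S j) = 0" by simp
    moreover have "S i \<inter> S j \<in> sets (Hk k)" using Ss ij by auto
    ultimately show ?thesis by (simp add: null_sets_def sets_Hk emeasure_Hk)
  qed
  \<comment> \<open>Removing the null overlaps makes the carriers genuinely disjoint, as the gluing
    requires.\<close>
  define R where "R i = (\<Union>j\<in>{..<M} - {i}. S i \<inter> S j)" for i
  define Q where "Q i = S i - R i" for i
  have R: "R i \<in> null_sets (Hk k)" if "i < M" for i
    unfolding R_def using that by (intro null_sets_UN' overlap) auto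
  have frQ: "framed k E (Q i) (\<lambda>x. s i * \<sigma> i x) (\<tau> i)" if "i < M" for i
    using framed_scale[OF framed_subset[OF fr[OF that], of "Q i"] s[OF that]] R[OF that] Ss[OF that]
    by (auto simp: Q_def hmeasurable_iff_sets null_sets_def)
  \<comment> \<open>Let \<open>m\<close> be the measure of \<open>S i\<close>. The factor
    \<open>1 - e'\<close> costs at most \<open>e' * m\<close>; the part off \<open>K i\<close>, of
    measure below \<open>e'\<close>, costs at most \<open>2 * e'\<close>, being lost to the good set
    and possibly carrying the value -1. After division by \<open>m\<close> the loss is
    \<open>e' * (1 + 2 / m)\<close>, and \<open>b\<close> dominates that bracket for all
    \<open>i\<close>.\<close>
  define b where "b = 1 + (\<Sum>i<M. 2 / ?m (S i))"
  have b: "1 + 2 / ?m (S i) \<le> b" if "i < M" for i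
    unfolding b_def using that pos by (intro add_left_mono member_le_sum) (auto simp: less_imp_le)
  have "0 \<le> (\<Sum>i<M. 2 / ?m (S i))"
    by (intro sum_nonneg) auto
  then have b1: "1 \<le> b" by (simp add: b_def)
  define e' where "e' = e / b"
  have e': "0 < e'" using e b1 by (simp add: e'_def)
  have disj: "disjoint_family_on Q {..<M}"
    by (auto simp: disjoint_family_on_def Q_def R_def)
  have "\<exists>\<omega>\<in>D0 k E. comass_le k E 1 \<omega> \<and> closure {x\<in>E. \<omega> x \<noteq> (\<lambda>_. 0)} \<subseteq> UNIV \<and>
    (\<exists>K. \<forall>i\<in>{..<M}. compact (K i) \<and> K i \<subseteq> Q i \<and> ?m (Q i - K i) < e'
        \<and> (\<forall>x\<in>K i. 1 - e' \<le> kpair k \<omega> (\<lambda>x. s i * \<sigma> i x) (\<tau> i) x))"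
    by (rule exists_almost_dual_form[OF E open_UNIV finite_lessThan _ subset_UNIV disj e']) (simp add: frQ)
  then obtain \<omega> K where \<omega>: "\<omega> \<in> D0 k E" "comass_le k E 1 \<omega>"
    and K: "\<forall>i\<in>{..<M}. compact (K i) \<and> K i \<subseteq> Q i \<and> ?m (Q i - K i) < e'
        \<and> (\<forall>x\<in>K i. 1 - e' \<le> kpair k \<omega> (\<lambda>x. s i * \<sigma> i x) (\<tau> i) x)"
    by blast
  show ?thesis
  proof (rule that[OF \<omega>])
    fix i assume i: "i < M"
    have Ki: "compact (K i)" "K i \<subseteq> Q i" "?m (Q i - K i) < e'"
      "\<And>x. x \<in> K i \<Longrightarrow> 1 - e' \<le> kpair k \<omega> (\<lambda>x. s i * \<sigma> i x) (\<tau> i) x"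
      using bspec[OF K, of i] i by auto
    have Ks: "K i \<in> sets (Hk k)" using Ki(1) by (rule compact_sets_Hk)
    have KS: "K i \<subseteq> S i" using Ki(2) by (auto simp: Q_def)
    have "?m (S i - K i) = ?m ((S i - K i) - R i)"
      using R[OF i] Ss[OF i] Ks by (intro measure_Diff_null_set[symmetric]) auto
    also have "(S i - K i) - R i = Q i - K i" by (auto simp: Q_def)
    finally have SK: "?m (S i - K i) < e'" using Ki(3) by simp
    have mK: "?m (K i) = ?m (S i) - ?m (S i - K i)"
      using measure_Diff[of "Hk k" "S i" "K i"] fin[of "S i" i] Ss[OF i] Ks KS i by simp
    have "(1 - e') * ?m (K i) - ?m (S i - K i) \<le> (LINT x:S i|Hk k. kpair k \<omega> (\<lambda>x. s i * \<sigma> i x) (\<tau> i) x)"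
      by (rule kpair_integral_lower_bound[OF framed_scale[OF fr[OF i] s[OF i]] \<omega>(1) E \<omega>(2) Ks KS Ki(4)])
         (use Ss[OF i] Ks in auto)
    also have "\<dots> = s i * T i \<omega> * ?m (S i)"
      using pos[OF i] by (simp add: kpair_scale Ti[OF i] avg_current_def)
    finally have 1: "(1 - e') * ?m (K i) - ?m (S i - K i) \<le> s i * T i \<omega> * ?m (S i)" .
    have "(1 - e) * ?m (S i) \<le> ?m (S i) - e' * (1 + 2 / ?m (S i)) * ?m (S i)"
    proof -
      have "e' * (1 + 2 / ?m (S i)) \<le> e"
        using b[OF i] b1 e by (simp add: e'_def divide_simps mult_left_mono)
      then have "e' * (1 + 2 / ?m (S i)) * ?m (S i) \<le> e * ?m (S i)"
        by (intro mult_right_mono) auto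
      then show ?thesis by (simp add: algebra_simps)
    qed
    also have "\<dots> = ?m (S i) - e' * ?m (S i) - 2 * e'"
      using pos[OF i] by (simp add: field_simps)
    also have "\<dots> \<le> (1 - e') * ?m (K i) - ?m (S i - K i)"
    proof -
      have "0 \<le> e' * ?m (S i - K i)" using e' by simp
      then show ?thesis
        unfolding mK using SK by (simp add: algebra_simps)
    qed
    finally have "(1 - e) * ?m (S i) \<le> s i * T i \<omega> * ?m (S i)" using 1 by linarith
    then show "1 - e \<le> s i * T i \<omega>" using pos[OF i] by simp
  qed
qed

subsection \<open>Least squares projectors and orthonormal bases\<close>

lemma lincomb_Suc: "lincomb (Suc n) c b = (\<lambda>x vs. c n * b n x vs + lincomb n c b x vs)"
  by (simp add: lincomb_def add.commute)

lemma lincomb_0: "lincomb 0 c b = (\<lambda>x vs. 0)"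
  by (simp add: lincomb_def)

lemma lincomb_linear:
  "(\<lambda>x vs. a * lincomb n c b x vs + lincomb n d b x vs) = lincomb n (\<lambda>h. a * c h + d h) b"
  by (simp add: lincomb_def sum_distrib_left sum.distrib algebra_simps)

lemma lincomb_cong: "(\<And>h. h < n \<Longrightarrow> c h = d h) \<Longrightarrow> (\<And>h. h < n \<Longrightarrow> b h = e h) \<Longrightarrow> lincomb n c b = lincomb n d e"
  by (simp add: lincomb_def)

lemma lincomb_in_fsubspace:
  assumes "fsubspace W" "\<And>h. h < n \<Longrightarrow> b h \<in> W"
  shows "lincomb n c b \<in> W"
  using assms(2)
proof (induction n)
  case 0
  then show ?case using assms(1) by (simp add: lincomb_0 fsubspace_def)
next
  case (Suc n)
  then show ?case using assms(1) by (simp add: lincomb_Suc fsubspace_def)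
qed

definition lspan :: "nat \<Rightarrow> (nat \<Rightarrow> 'a kform) \<Rightarrow> 'a kform set" where
  "lspan n b = range (\<lambda>c. lincomb n c b)"

lemma lspan_linear:
  assumes "\<omega> \<in> lspan n b" "\<theta> \<in> lspan n b"
  shows "(\<lambda>x vs. a * \<omega> x vs + \<theta> x vs) \<in> lspan n b"
  using assms by (auto simp: lspan_def lincomb_linear)

lemma lspan_Suc: "lspan (Suc n) b = {\<lambda>x vs. a * b n x vs + \<theta> x vs | a \<theta>. \<theta> \<in> lspan n b}"
proof (intro equalityI subsetI)
  fix \<omega> assume "\<omega> \<in> lspan (Suc n) b"
  then obtain c where "\<omega> = lincomb (Suc n) c b" by (auto simp: lspan_def)
  then have "\<omega> = (\<lambda>x vs. c n * b n x vs + lincomb n c b x vs)" by (simp add: lincomb_Suc)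
  moreover have "lincomb n c b \<in> lspan n b" by (auto simp: lspan_def)
  ultimately show "\<omega> \<in> {\<lambda>x vs. a * b n x vs + \<theta> x vs | a \<theta>. \<theta> \<in> lspan n b}" by blast
next
  fix \<omega> assume "\<omega> \<in> {\<lambda>x vs. a * b n x vs + \<theta> x vs | a \<theta>. \<theta> \<in> lspan n b}"
  then obtain a c where "\<omega> = (\<lambda>x vs. a * b n x vs + lincomb n c b x vs)" by (auto simp: lspan_def)
  also have "\<dots> = lincomb (Suc n) (c(n := a)) b"
    using lincomb_cong[of n "c(n := a)" c b b] by (simp add: lincomb_Suc)
  finally show "\<omega> \<in> lspan (Suc n) b" by (auto simp: lspan_def)
qed

lemma lspan_SucI:
  assumes "\<omega> = (\<lambda>x vs. a * b n x vs + \<theta> x vs)" "\<theta> \<in> lspan n b"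
  shows "\<omega> \<in> lspan (Suc n) b"
  unfolding lspan_Suc assms(1) using assms(2) by (intro CollectI exI[of _ a] exI[of _ \<theta>]) simp

text \<open>The finite-dimensional algebra, with currents seen as linear functionals on
  \<open>D\<close>. The ambient \<open>D\<close> appears beside \<open>V\<close> because the forms
  to be projected need not lie in \<open>V\<close>.\<close>

locale weighted_lsq =
  fixes D V :: "'a kform set" and M N :: nat
    and T :: "nat \<Rightarrow> 'a kform \<Rightarrow> real" and w :: "nat \<Rightarrow> real"
  assumes D: "fsubspace D" and VD: "V \<subseteq> D" and V: "fsubspace V" and dimV: "has_dim V N"
    and T_linear: "\<And>i a \<omega> \<theta>. i < M \<Longrightarrow> \<omega> \<in> D \<Longrightarrow> \<theta> \<in> D \<Longrightarrow>
          T i (\<lambda>x vs. a * \<omega> x vs + \<theta> x vs) = a * T i \<omega> + T i \<theta>"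
    and determ: "determining M T V" and w_pos: "\<And>i. i < M \<Longrightarrow> 0 < w i"
begin

abbreviation ip where "ip \<equiv> ipTw M T w"

lemma V_linear: "\<omega> \<in> V \<Longrightarrow> \<theta> \<in> V \<Longrightarrow> (\<lambda>x vs. a * \<omega> x vs + \<theta> x vs) \<in> V"
  using V by (simp add: fsubspace_def)

lemma ip_commute: "ip \<omega> \<theta> = ip \<theta> \<omega>"
  by (simp add: ipTw_def ac_simps)

lemma ip_linear:
  "\<omega> \<in> D \<Longrightarrow> \<theta> \<in> D \<Longrightarrow> ip (\<lambda>x vs. a * \<omega> x vs + \<theta> x vs) \<zeta> = a * ip \<omega> \<zeta> + ip \<theta> \<zeta>"
  unfolding ipTw_def sum_distrib_left sum.distrib[symmetric]
  by (intro sum.cong refl, subst T_linear) (simp_all add: algebra_simps)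

lemma ip_nonneg: "0 \<le> ip \<omega> \<omega>"
  unfolding ipTw_def using w_pos
  by (intro sum_nonneg) (simp add: mult.assoc less_imp_le)

text \<open>Positive weights make every \<open>T i\<close> vanish and the determining property does
  the rest. Definiteness is thus tied to \<open>V\<close>; on \<open>D\<close> only nonnegativity is
  available.\<close>

lemma ip_zero:
  assumes "\<omega> \<in> V" "ip \<omega> \<omega> = 0" shows "\<omega> = (\<lambda>x vs. 0)"
proof -
  have "\<forall>i\<in>{..<M}. w i * T i \<omega> * T i \<omega> = 0"
    using assms(2) w_pos unfolding ipTw_def
    by (subst (asm) sum_nonneg_eq_0_iff) (auto simp: mult.assoc less_imp_le)
  then have "\<forall>i<M. T i \<omega> = 0" using w_pos by (auto simp: less_le)
  then show ?thesis using determ assms(1) by (auto simp: determining_def)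
qed

lemma linear_functional_lincomb:
  assumes S: "\<And>a \<omega> \<theta>. \<omega> \<in> D \<Longrightarrow> \<theta> \<in> D \<Longrightarrow> S (\<lambda>x vs. a * \<omega> x vs + \<theta> x vs) = a * S \<omega> + S \<theta>"
    and b: "\<And>h. h < n \<Longrightarrow> b h \<in> D"
  shows "S (lincomb n c b) = (\<Sum>h<n. c h * (S (b h) :: real))"
  using b
proof (induction n)
  case 0
  have "(\<lambda>x vs. 0) \<in> D" using D by (simp add: fsubspace_def)
  \<comment> \<open>The instance \<open>S 0 = 1 * S 0 + S 0\<close> forces
    \<open>S 0 = 0\<close>.\<close>
  from S[OF this this, of 1] show ?case by (simp add: lincomb_0)
next
  case (Suc n)
  have "lincomb n c b \<in> D" using Suc.prems by (intro lincomb_in_fsubspace D) auto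
  then show ?case using S Suc by (simp add: lincomb_Suc)
qed

lemma ip_lincomb:
  "(\<And>h. h < n \<Longrightarrow> b h \<in> D) \<Longrightarrow> ip (lincomb n c b) \<zeta> = (\<Sum>h<n. c h * ip (b h) \<zeta>)"
  by (rule linear_functional_lincomb[where S="\<lambda>\<omega>. ip \<omega> \<zeta>"]) (simp add: ip_linear)

text \<open>Gram-Schmidt, with equality of spans as invariant. Independence of \<open>b\<close>
  keeps the residual \<open>r\<close> nonzero, and definiteness on \<open>V\<close> then allows its
  normalisation.\<close>

lemma onb_exists: "\<exists>\<eta>. is_onb M T w V N \<eta>"
proof -
  obtain b where b: "\<And>h. h < N \<Longrightarrow> b h \<in> V"
    and indep: "\<And>c. lincomb N c b = (\<lambda>x vs. 0) \<Longrightarrow> \<forall>h<N. c h = 0"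
    and gen: "\<And>\<omega>. \<omega> \<in> V \<Longrightarrow> \<exists>c. \<omega> = lincomb N c b"
    using dimV unfolding has_dim_def by blast
  have "\<exists>\<eta>. (\<forall>h<n. \<eta> h \<in> V) \<and> (\<forall>h<n. \<forall>h'<n. ip (\<eta> h) (\<eta> h') = (if h = h' then 1 else 0))
      \<and> lspan n \<eta> = lspan n b" if "n \<le> N" for n
    using that
  proof (induction n)
    case 0
    show ?case by (simp add: lspan_def lincomb_0)
  next
    case (Suc n)
    then obtain \<eta> where \<eta>: "\<And>h. h < n \<Longrightarrow> \<eta> h \<in> V"
      "\<And>h h'. h < n \<Longrightarrow> h' < n \<Longrightarrow> ip (\<eta> h) (\<eta> h') = (if h = h' then 1 else 0)"
      "lspan n \<eta> = lspan n b" by auto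
    have \<eta>D: "\<eta> h \<in> D" if "h < n" for h using \<eta>(1)[OF that] VD by blast
    have bn: "b n \<in> V" using b Suc.prems by simp
    define p where "p = lincomb n (\<lambda>h. ip (b n) (\<eta> h)) \<eta>"
    define r where "r = (\<lambda>x vs. -1 * p x vs + b n x vs)"
    have p: "p \<in> V" "p \<in> lspan n \<eta>"
      unfolding p_def using \<eta>(1) by (auto intro: lincomb_in_fsubspace V simp: lspan_def)
    have r: "r \<in> V" unfolding r_def by (rule V_linear[OF p(1) bn])
    have r_orth: "ip r (\<eta> h) = 0" if h: "h < n" for h
    proof -
      have "ip p (\<eta> h) = (\<Sum>h'<n. ip (b n) (\<eta> h') * ip (\<eta> h') (\<eta> h))"
        unfolding p_def by (rule ip_lincomb) (rule \<eta>D)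
      also have "\<dots> = (\<Sum>h'<n. if h' = h then ip (b n) (\<eta> h) else 0)"
        using h by (intro sum.cong) (auto simp: \<eta>(2))
      also have "\<dots> = ip (b n) (\<eta> h)" using h by simp
      finally show ?thesis
        unfolding r_def using p(1) bn VD by (subst ip_linear) auto
    qed
    have "r \<noteq> (\<lambda>x vs. 0)"
    proof
      assume r0: "r = (\<lambda>x vs. 0)"
      have "b n = p"
      proof (intro ext)
        fix x vs show "b n x vs = p x vs" using fun_cong[OF fun_cong[OF r0, of x], of vs] by (simp add: r_def)
      qed
      then obtain c where c: "b n = lincomb n c b" using p(2) \<eta>(3) by (auto simp: lspan_def)
      \<comment> \<open>If the residual vanished, \<open>b n\<close> would depend on its
        predecessors; the coefficient -1 at \<open>n\<close> contradicts independence, and zeros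
        extend the relation to length \<open>N\<close>.\<close>
      let ?c = "\<lambda>h. if h < n then c h else if h = n then -1 else 0"
      have "lincomb N ?c b = (\<lambda>x vs. \<Sum>h<Suc n. ?c h * b h x vs)"
        unfolding lincomb_def using Suc.prems by (intro ext sum.mono_neutral_right) auto
      also have "\<dots> = (\<lambda>x vs. 0)"
        using fun_cong[OF fun_cong[OF c]] by (simp add: lincomb_def)
      finally have "\<forall>h<N. ?c h = 0" by (rule indep)
      then have "?c n = 0" using Suc.prems by (auto dest: spec[of _ n])
      then show False by simp
    qed
    then have "ip r r \<noteq> 0" using ip_zero[OF r] by blast
    then have pos: "0 < ip r r" using ip_nonneg[of r] by simp
    define \<rho> where "\<rho> = sqrt (ip r r)"
    have \<rho>: "0 < \<rho>" "\<rho> * \<rho> = ip r r" using pos by (auto simp: \<rho>_def)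
    \<comment> \<open>The zero summand puts the rescaled \<open>r\<close> into the shape for which
      linearity and closure are stated.\<close>
    define z where "z = (\<lambda>x vs. (1/\<rho>) * r x vs + (\<lambda>x vs. 0) x vs)"
    have V0: "(\<lambda>x vs. 0) \<in> V" using V by (simp add: fsubspace_def)
    have z: "z \<in> V" unfolding z_def by (rule V_linear[OF r V0])
    have ip0: "ip (\<lambda>x vs. 0) \<zeta> = 0" for \<zeta>
      using ip_linear[of "\<lambda>x vs. 0" "\<lambda>x vs. 0" 1 \<zeta>] V0 VD by auto
    have ipz: "ip z \<zeta> = ip r \<zeta> / \<rho>" for \<zeta>
      unfolding z_def using r V0 VD by (subst ip_linear) (auto simp: ip0)
    have zz: "ip z z = 1"
    proof -
      have "ip z z = ip z r / \<rho>" by (subst ipz) (simp add: ip_commute)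
      also have "\<dots> = 1" using \<rho> pos by (simp add: ipz)
      finally show ?thesis .
    qed
    have zo: "ip z (\<eta> h) = 0" "ip (\<eta> h) z = 0" if "h < n" for h
      using r_orth[OF that] by (auto simp: ipz ip_commute[of "\<eta> h" z])
    have same: "lspan n (\<eta>(n := z)) = lspan n b"
    proof -
      have "lincomb n c (\<eta>(n := z)) = lincomb n c \<eta>" for c by (rule lincomb_cong) auto
      then have "lspan n (\<eta>(n := z)) = lspan n \<eta>" by (simp add: lspan_def)
      then show ?thesis using \<eta>(3) by simp
    qed
    have pb: "p \<in> lspan n b" using p(2) \<eta>(3) by simp
    have "lspan (Suc n) (\<eta>(n := z)) = lspan (Suc n) b"
    proof (intro equalityI subsetI)
      fix \<omega> assume "\<omega> \<in> lspan (Suc n) (\<eta>(n := z))"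
      then obtain a \<theta> where *: "\<omega> = (\<lambda>x vs. a * z x vs + \<theta> x vs)" "\<theta> \<in> lspan n b"
        by (auto simp: lspan_Suc same)
      have "\<omega> = (\<lambda>x vs. (a/\<rho>) * b n x vs + (- (a/\<rho>) * p x vs + \<theta> x vs))"
        unfolding * z_def r_def by (intro ext) (simp add: algebra_simps diff_divide_distrib)
      moreover have "(\<lambda>x vs. - (a/\<rho>) * p x vs + \<theta> x vs) \<in> lspan n b"
        by (rule lspan_linear[OF pb *(2)])
      ultimately show "\<omega> \<in> lspan (Suc n) b" by (rule lspan_SucI)
    next
      fix \<omega> assume "\<omega> \<in> lspan (Suc n) b"
      then obtain a \<theta> where *: "\<omega> = (\<lambda>x vs. a * b n x vs + \<theta> x vs)" "\<theta> \<in> lspan n b"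
        by (auto simp: lspan_Suc)
      have "\<omega> = (\<lambda>x vs. (a * \<rho>) * (\<eta>(n := z)) n x vs + (a * p x vs + \<theta> x vs))"
        unfolding * z_def r_def using \<rho>(1) by (intro ext) (simp add: algebra_simps)
      moreover have "(\<lambda>x vs. a * p x vs + \<theta> x vs) \<in> lspan n (\<eta>(n := z))"
        unfolding same by (rule lspan_linear[OF pb *(2)])
      ultimately show "\<omega> \<in> lspan (Suc n) (\<eta>(n := z))" by (rule lspan_SucI)
    qed
    note span = this
    show ?case
    proof (intro exI[of _ "\<eta>(n := z)"] conjI span)
      show "\<forall>h<Suc n. (\<eta>(n := z)) h \<in> V"
        using z \<eta>(1) by (simp add: less_Suc_eq)
      show "\<forall>h<Suc n. \<forall>h'<Suc n. ip ((\<eta>(n := z)) h) ((\<eta>(n := z)) h') = (if h = h' then 1 else 0)"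
        using zz zo \<eta>(2) by (auto simp: less_Suc_eq)
    qed
  qed
  from this[OF order_refl] obtain \<eta> where \<eta>: "\<forall>h<N. \<eta> h \<in> V"
    "\<forall>h<N. \<forall>h'<N. ip (\<eta> h) (\<eta> h') = (if h = h' then 1 else 0)" "lspan N \<eta> = lspan N b"
    by blast
  have "\<exists>c. \<omega> = lincomb N c \<eta>" if "\<omega> \<in> V" for \<omega>
  proof -
    have "\<omega> \<in> lspan N b" using gen[OF that] by (auto simp: lspan_def)
    then show ?thesis unfolding \<eta>(3)[symmetric] by (auto simp: lspan_def)
  qed
  then show ?thesis
    using \<eta>(1,2) unfolding is_onb_def by blast
qed

text \<open>The Fourier sum \<open>p\<close> leaves a residual orthogonal to \<open>V\<close>, so
  Pythagoras makes it a minimiser. Another minimiser differs from it by an element of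
  \<open>V\<close> of zero length, which gives the uniqueness that \<open>THE\<close> needs.\<close>

lemma lsq_proj_onb:
  assumes onb: "is_onb M T w V N \<eta>" and \<omega>: "\<omega> \<in> D"
  shows "lsq_proj M T w V \<omega> = lincomb N (\<lambda>h. ip \<omega> (\<eta> h)) \<eta>"
proof -
  define p where "p = lincomb N (\<lambda>h. ip \<omega> (\<eta> h)) \<eta>"
  have \<eta>: "\<And>h. h < N \<Longrightarrow> \<eta> h \<in> V" "\<And>h. h < N \<Longrightarrow> \<eta> h \<in> D"
    "\<And>h h'. h < N \<Longrightarrow> h' < N \<Longrightarrow> ip (\<eta> h) (\<eta> h') = (if h = h' then 1 else 0)"
    "\<And>\<theta>. \<theta> \<in> V \<Longrightarrow> \<exists>c. \<theta> = lincomb N c \<eta>"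
    using onb VD by (auto simp: is_onb_def)
  have pV: "p \<in> V" unfolding p_def by (intro lincomb_in_fsubspace V \<eta>)
  have pD: "p \<in> D" using pV VD by blast
  have Tdiff: "T i (\<lambda>x vs. \<alpha> x vs - \<beta> x vs) = T i \<alpha> - T i \<beta>" if "i < M" "\<alpha> \<in> D" "\<beta> \<in> D" for i \<alpha> \<beta>
    using T_linear[OF that(1,3,2), of "-1"] by (simp add: algebra_simps)
  have ipdiff: "ip (\<lambda>x vs. \<alpha> x vs - \<beta> x vs) \<zeta> = ip \<alpha> \<zeta> - ip \<beta> \<zeta>" if "\<alpha> \<in> D" "\<beta> \<in> D" for \<alpha> \<beta> \<zeta>
    using that by (simp add: ipTw_def Tdiff algebra_simps sum_subtractf)
  have diffV: "(\<lambda>x vs. \<alpha> x vs - \<beta> x vs) \<in> V" if "\<alpha> \<in> V" "\<beta> \<in> V" for \<alpha> \<beta>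
    using V_linear[OF that(2,1), of "-1"] by (simp add: algebra_simps)
  have orth\<eta>: "ip \<omega> (\<eta> h) = ip p (\<eta> h)" if h: "h < N" for h
  proof -
    have "ip p (\<eta> h) = (\<Sum>h'<N. ip \<omega> (\<eta> h') * ip (\<eta> h') (\<eta> h))"
      unfolding p_def by (rule ip_lincomb) (rule \<eta>)
    also have "\<dots> = (\<Sum>h'<N. if h' = h then ip \<omega> (\<eta> h) else 0)"
      using h by (intro sum.cong) (auto simp: \<eta>(3))
    finally show ?thesis using h by simp
  qed
  have orth: "ip \<omega> \<zeta> = ip p \<zeta>" if \<zeta>: "\<zeta> \<in> V" for \<zeta>
  proof -
    obtain c where c: "\<zeta> = lincomb N c \<eta>" using \<eta>(4)[OF \<zeta>] by blast
    have "ip \<zeta> \<alpha> = (\<Sum>h<N. c h * ip (\<eta> h) \<alpha>)" for \<alpha>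
      unfolding c by (rule ip_lincomb) (rule \<eta>)
    then show ?thesis
      by (simp add: ip_commute[of _ \<zeta>] ip_commute[of "\<eta> _"] orth\<eta>)
  qed
  have pyth: "ip (\<lambda>x vs. \<omega> x vs - \<theta> x vs) (\<lambda>x vs. \<omega> x vs - \<theta> x vs)
      = ip (\<lambda>x vs. \<omega> x vs - p x vs) (\<lambda>x vs. \<omega> x vs - p x vs)
        + ip (\<lambda>x vs. p x vs - \<theta> x vs) (\<lambda>x vs. p x vs - \<theta> x vs)" if \<theta>: "\<theta> \<in> V" for \<theta>
  proof -
    have \<theta>D: "\<theta> \<in> D" using \<theta> VD by blast
    have expand: "ip (\<lambda>x vs. \<alpha> x vs - \<beta> x vs) (\<lambda>x vs. \<alpha> x vs - \<beta> x vs) = ip \<alpha> \<alpha> - 2 * ip \<alpha> \<beta> + ip \<beta> \<beta>"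
      if "\<alpha> \<in> D" "\<beta> \<in> D" for \<alpha> \<beta>
      using ipdiff[OF that] ip_commute[of \<alpha> "\<lambda>x vs. \<alpha> x vs - \<beta> x vs"]
        ip_commute[of \<beta> "\<lambda>x vs. \<alpha> x vs - \<beta> x vs"] ip_commute[of \<beta> \<alpha>] by simp
    show ?thesis
      using expand[OF \<omega> \<theta>D] expand[OF \<omega> pD] expand[OF pD \<theta>D] orth[OF \<theta>] orth[OF pV] by simp
  qed
  have "lsq_proj M T w V \<omega> = p"
    unfolding lsq_proj_def
  proof (rule the_equality)
    show "p \<in> V \<and> (\<forall>\<theta>'\<in>V. ip (\<lambda>x vs. \<omega> x vs - p x vs) (\<lambda>x vs. \<omega> x vs - p x vs)
        \<le> ip (\<lambda>x vs. \<omega> x vs - \<theta>' x vs) (\<lambda>x vs. \<omega> x vs - \<theta>' x vs))"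
    proof (intro conjI pV ballI)
      fix \<theta>' assume "\<theta>' \<in> V"
      then show "ip (\<lambda>x vs. \<omega> x vs - p x vs) (\<lambda>x vs. \<omega> x vs - p x vs)
          \<le> ip (\<lambda>x vs. \<omega> x vs - \<theta>' x vs) (\<lambda>x vs. \<omega> x vs - \<theta>' x vs)"
        unfolding pyth[OF \<open>\<theta>' \<in> V\<close>] using ip_nonneg[of "\<lambda>x vs. p x vs - \<theta>' x vs"] by linarith
    qed
    fix \<theta> assume \<theta>: "\<theta> \<in> V \<and> (\<forall>\<theta>'\<in>V. ip (\<lambda>x vs. \<omega> x vs - \<theta> x vs) (\<lambda>x vs. \<omega> x vs - \<theta> x vs)
        \<le> ip (\<lambda>x vs. \<omega> x vs - \<theta>' x vs) (\<lambda>x vs. \<omega> x vs - \<theta>' x vs))"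
    then have \<theta>V: "\<theta> \<in> V" and le: "ip (\<lambda>x vs. \<omega> x vs - \<theta> x vs) (\<lambda>x vs. \<omega> x vs - \<theta> x vs)
        \<le> ip (\<lambda>x vs. \<omega> x vs - p x vs) (\<lambda>x vs. \<omega> x vs - p x vs)"
      using pV by blast+
    have "ip (\<lambda>x vs. p x vs - \<theta> x vs) (\<lambda>x vs. p x vs - \<theta> x vs) = 0"
      using le pyth[OF \<theta>V] ip_nonneg[of "\<lambda>x vs. p x vs - \<theta> x vs"] by linarith
    then have zero: "(\<lambda>x vs. p x vs - \<theta> x vs) = (\<lambda>x vs. 0)"
      using \<theta>V by (intro ip_zero diffV pV)
    show "\<theta> = p"
    proof (intro ext)
      fix x vs show "\<theta> x vs = p x vs" using fun_cong[OF fun_cong[OF zero, of x], of vs] by simp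
    qed
  qed
  then show ?thesis by (simp add: p_def)
qed

text \<open>Exchanging the sums over \<open>h\<close> and \<open>i\<close> shows \<open>S\<close>
  after projection as a combination of the \<open>T i\<close>; the inner sum over \<open>h\<close>
  is a discrete reproducing kernel.\<close>

lemma functional_lsq_proj:
  assumes onb: "is_onb M T w V N \<eta>" and \<omega>: "\<omega> \<in> D"
    and S: "\<And>a \<omega> \<theta>. \<omega> \<in> D \<Longrightarrow> \<theta> \<in> D \<Longrightarrow> S (\<lambda>x vs. a * \<omega> x vs + \<theta> x vs) = a * S \<omega> + S \<theta>"
  shows "S (lsq_proj M T w V \<omega>) = (\<Sum>i<M. w i * T i \<omega> * (\<Sum>h<N. T i (\<eta> h) * S (\<eta> h)))"
proof -
  have "\<eta> h \<in> D" if "h < N" for h using onb VD that by (auto simp: is_onb_def)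
  then have "S (lsq_proj M T w V \<omega>) = (\<Sum>h<N. ip \<omega> (\<eta> h) * S (\<eta> h))"
    unfolding lsq_proj_onb[OF onb \<omega>] by (intro linear_functional_lincomb S)
  also have "\<dots> = (\<Sum>h<N. \<Sum>i<M. w i * T i \<omega> * (T i (\<eta> h) * S (\<eta> h)))"
    by (simp add: ipTw_def sum_distrib_right mult.assoc)
  also have "\<dots> = (\<Sum>i<M. w i * T i \<omega> * (\<Sum>h<N. T i (\<eta> h) * S (\<eta> h)))"
    by (subst sum.swap) (simp add: sum_distrib_left)
  finally show ?thesis .
qed

end

subsection \<open>The operator norm of the projector\<close>

lemma norm0_scale_le:
  assumes ne: "Ak k E \<noteq> {}" and E: "compact E" and \<omega>: "\<omega> \<in> D0 k E" and a: "0 < a"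
  shows "norm0 k E (\<lambda>x vs. a * \<omega> x vs) \<le> a * norm0 k E \<omega>"
  unfolding norm0_def[of k E "\<lambda>x vs. a * \<omega> x vs"]
proof (rule cSUP_least[OF ne])
  fix T assume T: "T \<in> Ak k E"
  have z: "T (\<lambda>x vs. 0) = 0"
    using Ak_linear[OF T E D0_zero D0_zero, of 1] by simp
  have "T (\<lambda>x vs. a * \<omega> x vs) = a * T \<omega>"
    using Ak_linear[OF T E \<omega> D0_zero, of a] z by simp
  then show "\<bar>T (\<lambda>x vs. a * \<omega> x vs)\<bar> \<le> a * norm0 k E \<omega>"
    using Ak_le_norm0[OF T E \<omega>] a by (simp add: abs_mult)
qed

lemma D0_scale: "\<omega> \<in> D0 k E \<Longrightarrow> (\<lambda>x vs. a * \<omega> x vs) \<in> D0 k E"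
  using D0_linear[OF _ D0_zero, of \<omega> k E a] by simp

text \<open>The reverse inequality is the one-sided bound for the factor \<open>1/a\<close>, applied
  to the scaled form.\<close>

lemma norm0_scale:
  assumes ne: "Ak k E \<noteq> {}" and E: "compact E" and \<omega>: "\<omega> \<in> D0 k E" and a: "0 < a"
  shows "norm0 k E (\<lambda>x vs. a * \<omega> x vs) = a * norm0 k E \<omega>"
proof (rule antisym)
  show "norm0 k E (\<lambda>x vs. a * \<omega> x vs) \<le> a * norm0 k E \<omega>" by (rule norm0_scale_le[OF assms])
  have "norm0 k E (\<lambda>x vs. (1/a) * (a * \<omega> x vs)) \<le> (1/a) * norm0 k E (\<lambda>x vs. a * \<omega> x vs)"
    using a by (intro norm0_scale_le ne E D0_scale \<omega>) auto
  then show "a * norm0 k E \<omega> \<le> norm0 k E (\<lambda>x vs. a * \<omega> x vs)"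
    using a by (simp add: field_simps)
qed

lemma fsubspace_D0: "fsubspace (D0 k E)"
  by (simp add: fsubspace_def D0_zero D0_linear)

text \<open>If there are no averaging currents (e.g. for \<open>k > n\<close>), every supremum involved is the junk value
  \<open>Sup {}\<close> or the supremum of \<open>{Sup {}}\<close>.\<close>
lemma opnorm0_Ak_empty:
  assumes "Ak k E = {}"
  shows "opnorm0 k E P = Mconst k E M T w V N"
proof -
  have n: "norm0 k E \<omega> = Sup {}" for \<omega> using assms by (simp add: norm0_def)
  have "{norm0 k E (P \<omega>) | \<omega>. \<omega> \<in> D0 k E \<and> norm0 k E \<omega> = 1} = (if Sup {} = (1::real) then {1} else {})"
    using D0_zero unfolding n by auto
  then show ?thesis
    using assms by (auto simp: opnorm0_def Mconst_def Let_def)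
qed

locale avg_current_lsq = weighted_lsq "D0 k E" V M N T w
  for k :: nat and E :: "'a::euclidean_space set" and V M N T w +
  assumes E: "compact E" and T_Ak: "\<And>i. i < M \<Longrightarrow> T i \<in> Ak k E" and Ak_ne: "Ak k E \<noteq> {}"
begin

text \<open>The very choice term inside \<open>Mconst\<close>, so no independence from the basis has
  to be shown.\<close>

definition \<eta>0 where "\<eta>0 = (SOME \<eta>. is_onb M T w V N \<eta>)"

text \<open>The Lebesgue function of the projector with currents in place of points; its supremum
  generalises the Lebesgue constant of interpolation.\<close>

definition lebesgue_fun :: "('a kform \<Rightarrow> real) \<Rightarrow> real" where
  "lebesgue_fun S = (\<Sum>i<M. w i * \<bar>\<Sum>h<N. T i (\<eta>0 h) * S (\<eta>0 h)\<bar>)"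

abbreviation P where "P \<equiv> lsq_proj M T w V"
abbreviation nrm where "nrm \<equiv> norm0 k E"
abbreviation MM where "MM \<equiv> Mconst k E M T w V N"

lemma onb: "is_onb M T w V N \<eta>0"
  unfolding \<eta>0_def using onb_exists by (rule someI_ex)

lemma Mconst_eq: "MM = Sup (lebesgue_fun ` Ak k E)"
  by (simp add: Mconst_def lebesgue_fun_def[abs_def] \<eta>0_def Let_def)

lemma \<eta>0_D0: "h < N \<Longrightarrow> \<eta>0 h \<in> D0 k E"
  using onb VD by (auto simp: is_onb_def)

lemma P_D0: "\<omega> \<in> D0 k E \<Longrightarrow> P \<omega> \<in> D0 k E"
  by (simp add: lsq_proj_onb[OF onb] lincomb_in_fsubspace[OF D] \<eta>0_D0)

lemma apply_P:
  "S \<in> Ak k E \<Longrightarrow> \<omega> \<in> D0 k E \<Longrightarrow>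
    S (P \<omega>) = (\<Sum>i<M. w i * T i \<omega> * (\<Sum>h<N. T i (\<eta>0 h) * S (\<eta>0 h)))"
  using functional_lsq_proj[OF onb, of \<omega> S] Ak_linear[OF _ E] by blast

text \<open>Each basis form has finite \<open>norm0\<close>, which bounds
  \<open>S (\<eta>0 h)\<close> uniformly in \<open>S\<close>.\<close>

lemma lebesgue_fun_bdd: "bdd_above (lebesgue_fun ` Ak k E)"
proof (rule bdd_aboveI2)
  fix S assume S: "S \<in> Ak k E"
  show "lebesgue_fun S \<le> (\<Sum>i<M. w i * (\<Sum>h<N. \<bar>T i (\<eta>0 h)\<bar> * nrm (\<eta>0 h)))"
    unfolding lebesgue_fun_def
  proof (intro sum_mono mult_left_mono)
    fix i assume i: "i \<in> {..<M}"
    show "\<bar>\<Sum>h<N. T i (\<eta>0 h) * S (\<eta>0 h)\<bar> \<le> (\<Sum>h<N. \<bar>T i (\<eta>0 h)\<bar> * nrm (\<eta>0 h))"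
      by (rule order_trans[OF sum_abs])
         (auto simp: abs_mult intro!: sum_mono mult_left_mono Ak_le_norm0[OF S E \<eta>0_D0])
  qed (use w_pos in \<open>auto intro: less_imp_le\<close>)
qed

lemma norm0_P_le:
  assumes \<omega>: "\<omega> \<in> D0 k E"
  shows "nrm (P \<omega>) \<le> nrm \<omega> * MM"
  unfolding norm0_def[of k E "P \<omega>"]
proof (rule cSUP_least[OF Ak_ne])
  fix S assume S: "S \<in> Ak k E"
  have n0: "0 \<le> nrm \<omega>" using Ak_le_norm0[OF S E \<omega>] by linarith
  have "\<bar>S (P \<omega>)\<bar> \<le> (\<Sum>i<M. nrm \<omega> * (w i * \<bar>\<Sum>h<N. T i (\<eta>0 h) * S (\<eta>0 h)\<bar>))"
    unfolding apply_P[OF S \<omega>]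
  proof (rule order_trans[OF sum_abs sum_mono])
    fix i assume "i \<in> {..<M}"
    then have i: "i < M" by simp
    have "w i * \<bar>T i \<omega>\<bar> * \<bar>\<Sum>h<N. T i (\<eta>0 h) * S (\<eta>0 h)\<bar>
        \<le> w i * nrm \<omega> * \<bar>\<Sum>h<N. T i (\<eta>0 h) * S (\<eta>0 h)\<bar>"
      using w_pos[OF i] Ak_le_norm0[OF T_Ak[OF i] E \<omega>] by (intro mult_right_mono mult_left_mono) auto
    then show "\<bar>w i * T i \<omega> * (\<Sum>h<N. T i (\<eta>0 h) * S (\<eta>0 h))\<bar>
        \<le> nrm \<omega> * (w i * \<bar>\<Sum>h<N. T i (\<eta>0 h) * S (\<eta>0 h)\<bar>)"
      using w_pos[OF i] by (simp add: abs_mult mult_ac)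
  qed
  also have "\<dots> = nrm \<omega> * lebesgue_fun S"
    by (simp add: lebesgue_fun_def sum_distrib_left)
  also have "\<dots> \<le> nrm \<omega> * MM"
    unfolding Mconst_eq by (intro mult_left_mono cSUP_upper S lebesgue_fun_bdd n0)
  finally show "\<bar>S (P \<omega>)\<bar> \<le> nrm \<omega> * MM" .
qed

text \<open>Keeps the set behind \<open>opnorm0\<close> nonempty: a form almost dual to any one
  current has positive norm and can be normalised.\<close>

lemma exists_norm0_eq_1: "\<exists>\<omega>\<in>D0 k E. nrm \<omega> = 1"
proof -
  obtain S where S: "S \<in> Ak k E" using Ak_ne by blast
  obtain \<omega> where \<omega>: "\<omega> \<in> D0 k E" and "\<And>i. i < (1::nat) \<Longrightarrow> 1 - 1/2 \<le> 1 * S \<omega>"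
    by (rule almost_dual_form_avg_currents[OF E, where M=1 and T="\<lambda>_. S" and s="\<lambda>_. 1" and e="1/2" and k=k])
       (use S in auto)
  then have "1/2 \<le> S \<omega>" by auto
  then have pos: "0 < nrm \<omega>" using Ak_le_norm0[OF S E \<omega>] by linarith
  then have "nrm (\<lambda>x vs. (1 / nrm \<omega>) * \<omega> x vs) = 1"
    by (subst norm0_scale[OF Ak_ne E \<omega>]) auto
  then show ?thesis using D0_scale[OF \<omega>] by blast
qed

lemma opnorm0_le_Mconst: "opnorm0 k E P \<le> MM"
  unfolding opnorm0_def
proof (rule cSup_least)
  show "{nrm (P \<omega>) |\<omega>. \<omega> \<in> D0 k E \<and> nrm \<omega> = 1} \<noteq> {}" using exists_norm0_eq_1 by auto
  fix y assume "y \<in> {nrm (P \<omega>) |\<omega>. \<omega> \<in> D0 k E \<and> nrm \<omega> = 1}"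
  then show "y \<le> MM" using norm0_P_le by fastforce
qed

lemma norm0_P_le_opnorm0:
  assumes "\<omega> \<in> D0 k E" "nrm \<omega> = 1"
  shows "nrm (P \<omega>) \<le> opnorm0 k E P"
  unfolding opnorm0_def
proof (rule cSup_upper)
  show "bdd_above {nrm (P \<omega>) |\<omega>. \<omega> \<in> D0 k E \<and> nrm \<omega> = 1}"
    by (rule bdd_aboveI[of _ MM]) (use norm0_P_le in fastforce)
qed (use assms in blast)

text \<open>For fixed \<open>S\<close>, a form almost dual to the \<open>T i\<close> with the signs
  of the kernel sums makes all terms of the expansion add up without cancellation.\<close>

lemma Mconst_le_opnorm0:
  assumes supp: "\<And>i j. i < M \<Longrightarrow> j < M \<Longrightarrow> i \<noteq> j \<Longrightarrow> hausdorff_outer k (fsupp k E (T i) \<inter> fsupp k E (T j)) = 0"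
  shows "MM \<le> opnorm0 k E P"
  unfolding Mconst_eq
proof (rule cSUP_least[OF Ak_ne])
  fix S assume S: "S \<in> Ak k E"
  have upper: "S (P \<omega>) \<le> opnorm0 k E P" if "\<omega> \<in> D0 k E" "nrm \<omega> = 1" for \<omega>
    using Ak_le_norm0[OF S E P_D0[OF that(1)]] norm0_P_le_opnorm0[OF that] by linarith
  show "lebesgue_fun S \<le> opnorm0 k E P"
  proof (cases "M = 0")
    \<comment> \<open>Without a \<open>T 0\<close> the norm of the test form has no lower bound
      here; both sides of the identity are empty sums, and any normalised form serves.\<close>
    case True
    obtain \<omega> where \<omega>: "\<omega> \<in> D0 k E" "nrm \<omega> = 1" using exists_norm0_eq_1 by blast
    have "lebesgue_fun S = S (P \<omega>)"
      unfolding lebesgue_fun_def apply_P[OF S \<omega>(1)] by (simp add: True)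
    then show ?thesis using upper[OF \<omega>] by simp
  next
    case False
    define g where "g i = (\<Sum>h<N. T i (\<eta>0 h) * S (\<eta>0 h))" for i
    define s :: "nat \<Rightarrow> real" where "s i = (if 0 \<le> g i then 1 else -1)" for i
    show ?thesis
    \<comment> \<open>The almost dual form loses a factor; it suffices to reach \<open>z\<close>
      times the value for every \<open>z\<close> below 1, with error \<open>1 - z\<close>.\<close>
    proof (rule field_le_mult_one_interval)
      fix z :: real assume z: "0 < z" "z < 1"
      obtain \<omega> where \<omega>: "\<omega> \<in> D0 k E" "comass_le k E 1 \<omega>" and T\<omega>: "\<And>i. i < M \<Longrightarrow> 1 - (1 - z) \<le> s i * T i \<omega>"
        by (rule almost_dual_form_avg_currents[OF E, where M=M and T=T and s=s and e="1 - z" and k=k])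
           (use T_Ak supp z in \<open>auto simp: s_def\<close>)
      have c1: "nrm \<omega> \<le> 1"
        unfolding norm0_def by (rule cSUP_least[OF Ak_ne]) (rule Ak_bound[OF _ E \<omega>])
      \<comment> \<open>One current suffices to show that the test form has positive norm and can be
        normalised.\<close>
      have "z \<le> \<bar>T 0 \<omega>\<bar>"
        using T\<omega>[of 0] False by (auto simp: s_def split: if_splits)
      also have "\<dots> \<le> nrm \<omega>" using False by (intro Ak_le_norm0[OF T_Ak E \<omega>(1)]) simp
      finally have c0: "0 < nrm \<omega>" using z by linarith
      define \<omega>' where "\<omega>' = (\<lambda>x vs. (1 / nrm \<omega>) * \<omega> x vs)"
      have \<omega>': "\<omega>' \<in> D0 k E" "nrm \<omega>' = 1"
      proof -
        show "\<omega>' \<in> D0 k E" unfolding \<omega>'_def by (rule D0_scale[OF \<omega>(1)])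
        show "nrm \<omega>' = 1"
          unfolding \<omega>'_def using c0 by (subst norm0_scale[OF Ak_ne E \<omega>(1)]) auto
      qed
      have "z * lebesgue_fun S = (\<Sum>i<M. z * (w i * \<bar>g i\<bar>))"
        by (simp add: lebesgue_fun_def g_def sum_distrib_left)
      also have "\<dots> \<le> (\<Sum>i<M. w i * T i \<omega>' * g i)"
      proof (rule sum_mono)
        fix i assume "i \<in> {..<M}"
        then have i: "i < M" by simp
        have "T i (\<lambda>x vs. 0) = 0"
          using Ak_linear[OF T_Ak[OF i] E D0_zero D0_zero, of 1] by simp
        then have Ti: "T i \<omega>' = T i \<omega> / nrm \<omega>"
          unfolding \<omega>'_def using Ak_linear[OF T_Ak[OF i] E \<omega>(1) D0_zero, of "1 / nrm \<omega>"] by simp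
        have "z \<le> s i * T i \<omega>" using T\<omega>[OF i] by simp
        \<comment> \<open>Normalising divides a positive value by a norm at most 1, so the lower
          bound survives.\<close>
        also have "\<dots> \<le> s i * T i \<omega> / nrm \<omega>"
          using c0 c1 z \<open>z \<le> s i * T i \<omega>\<close> by (simp add: le_divide_eq mult_left_le)
        finally have "z * (w i * \<bar>g i\<bar>) \<le> (s i * T i \<omega>') * (w i * \<bar>g i\<bar>)"
          using w_pos[OF i] by (intro mult_right_mono) (auto simp: Ti)
        \<comment> \<open>The sign satisfies \<open>s i * \<bar>g i\<bar> = g i\<close>, also for
          \<open>g i = 0\<close>.\<close>
        also have "\<dots> = w i * T i \<omega>' * g i" by (simp add: s_def)
        finally show "z * (w i * \<bar>g i\<bar>) \<le> w i * T i \<omega>' * g i" .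
      qed
      also have "\<dots> = S (P \<omega>')" by (simp add: apply_P[OF S \<omega>'(1)] g_def)
      also have "\<dots> \<le> opnorm0 k E P" by (rule upper[OF \<omega>'])
      finally show "z * lebesgue_fun S \<le> opnorm0 k E P" .
    qed
  qed
qed

end

theorem mainTheorem7:
  fixes \<Omega> :: "'a::euclidean_space set"
    and k N M :: nat
    and V :: "'a kform set"
    and T :: "nat \<Rightarrow> 'a kform \<Rightarrow> real"
    and w :: "nat \<Rightarrow> real"
  assumes "lipschitz_domain \<Omega>"
    and "V \<subseteq> D0 k (closure \<Omega>)" and "fsubspace V" and "has_dim V N"
    and "\<forall>i<M. T i \<in> Ak k (closure \<Omega>)"
    and "determining M T V"
    and "\<forall>i<M. 0 < w i"
  shows "opnorm0 k (closure \<Omega>) (lsq_proj M T w V) \<le> Mconst k (closure \<Omega>) M T w V N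
     \<and> ((\<forall>i<M. \<forall>j<M. i \<noteq> j \<longrightarrow>
            hausdorff_outer k (fsupp k (closure \<Omega>) (T i) \<inter> fsupp k (closure \<Omega>) (T j)) = 0)
         \<longrightarrow> opnorm0 k (closure \<Omega>) (lsq_proj M T w V) = Mconst k (closure \<Omega>) M T w V N)"
proof (cases "Ak k (closure \<Omega>) = {}")
  case True
  then show ?thesis
    using opnorm0_Ak_empty[OF True, where P="lsq_proj M T w V" and M=M and T=T and w=w and V=V and N=N]
    by simp
next
  case False
  have E: "compact (closure \<Omega>)"
    using assms(1) by (simp add: lipschitz_domain_def compact_closure)
  interpret avg_current_lsq k "closure \<Omega>" V M N T w
  proof unfold_locales
    show "T i (\<lambda>x vs. a * \<omega> x vs + \<theta> x vs) = a * T i \<omega> + T i \<theta>"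
      if "i < M" "\<omega> \<in> D0 k (closure \<Omega>)" "\<theta> \<in> D0 k (closure \<Omega>)" for i a \<omega> \<theta>
      using Ak_linear[OF _ E that(2,3)] assms(5) that(1) by blast
  qed (use assms E False in \<open>auto simp: fsubspace_D0\<close>)
  show ?thesis
    using opnorm0_le_Mconst Mconst_le_opnorm0 by (auto intro!: antisym)
qed

end
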